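(* Let $n\ge 4$ be an integer, let $\mathcal G=(Q,\{u_1,\dots,u_n\})$ be a seed of type $\mathbb D_n$ whose two fork arrows either both enter the joint or both leave the joint, and let $\bar{\mathcal F}$ be the modelled quiver associated with $\mathcal G$. Then $\bar{\mathcal F}$ (as a quiver with values attached to its vertices) is a full sub-quiver of a fundamental quiver in the frieze of type $\mathbb A_{2n-1}$ associated with $\Lambda'$, where $u_0$ is set equal to $1$. The descending diagonal $d_1$ which bounds this fundamental quiver passes through the $(n+1)$th vertex of $\Lambda'$ (whose associated variable is $u_1u_2$), i.e. through the vertex $(0,n+1)$ of the frieze.
   Context: **Translation quivers and friezes.** For a finite acyclic quiver $\Theta$ with vertex set $\Theta_0$ and arrow set $\Theta_1$, the translation quiver $\mathbb Z\Theta$ has vertices $(k,i)$, $k\in\mathbb Z$, $i\in\Theta_0$, and, for each $k\in\mathbb Z$ and each arrow $i\to j$ of $\Theta$, an arrow $(k,i)\to(k,j)$ and an arrow $(k,j)\to(k+1,i)$. Given initial values $\mathfrak a(0,i)$ in a field, the frieze associated with $\Theta$ is $\mathbb Z\Theta$ with values $\mathfrak a(k,i)$ attached to its vertices, determined by $$\mathfrak a(k,i)\,\mathfrak a(k+1,i)=1+\prod_{(k,i)\to(m,j)}\mathfrak a(m,j),$$ the product running over the arrows of $\mathbb Z\Theta$ starting at $(k,i)$. A point of the frieze is identified with its value. Here all values lie in $\mathbb Q(u_1,\dots,u_n)$ with $u_1,\dots,u_n$ independent variables. **Type $\mathbb A_N$: diagonals and fundamental quivers.** Let $\Theta$ be of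 type $\mathbb A_N$, drawn horizontally with vertices numbered $1,\dots,N$ from left to right. In $\mathbb Z\Theta$, arrows from a vertex $(\cdot,j)$ to a vertex $(\cdot,j+1)$ are drawn north-east and arrows from $(\cdot,j+1)$ to $(\cdot,j)$ are drawn south-east (so row $N$ is at the top and row $1$ at the bottom). A descending (resp. ascending) diagonal is a path of $N-1$ consecutive south-east (resp. north-east) arrows starting at some $(k,N)$ (resp. at some $(k,1)$). For $k_0\in\mathbb Z$, let $d_1$ be the descending diagonal starting at $(k_0,N)$ and $d_2$ the ascending diagonal ending at $(k_0+N,N)$. The fundamental quiver (for $k_0$) is the portion of $\mathbb Z\Theta$ (with its values) bounded by $d_1$ and $d_2$, inclusively. **Type $\mathbb D_n$.** The quiver $Q$ of type $\mathbb D_n$ has vertices $1,\dots,n$, with edges $1-3$, $2-3$, $3-4$, $4-5,\dots,(n-1)-n$, each given some orientation. The vertices $1,2$ are the fork vertices, $3$ is the joint, and the fork arrows are the arrows on the edges $1-3$ and $2-3$. With the seed $\mathcal G=(Q,\{u_1,\dots,u_n\})$ one associates the frieze of $Q$ with initial values $\mathfrak a(0,i)=u_i$. Let $\mathcal F$ be the part of this frieze consisting of the vertices $(k,i)$ with $0\le k\le n$, $1\le i\le n$, and the arrows between them. **Modelled quiver.** Assume the fork arrows both enter or both leave the joint. The modelled quiver $\bar{\mathcal F}$ is obtained from $\mathcal F$ by merging, for each $k$, the vertices $(k,1)$ and $(k,2)$ into a single vertex (still written $(k,1)$), the arrows of each copy of the fork being glued correspondingly, and attaching to the merged vertex the value $\mathfrak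 a(k,1)\mathfrak a(k,2)$; all other vertices $(k,i)$, $3\le i\le n$, keep their value $\mathfrak a(k,i)$. **The seed $\Lambda'$.** Let $\bar\omega$ be the full sub-quiver of $Q$ on all vertices except $2$, drawn from left to right in the order $1,3,4,\dots,n$ (type $\mathbb A_{n-1}$). Let ${}^t\bar\omega$ be the same quiver redrawn from right to left (order $n,\dots,4,3,1$; an arrow pointing right in $\bar\omega$ points left in ${}^t\bar\omega$ and vice versa). Let $Q'$ be the quiver ${}^t\bar\omega\to 0\to\bar\omega$ of type $\mathbb A_{2n-1}$, i.e. drawn left to right its vertices are labelled $n,n-1,\dots,4,3,1,0,1,3,4,\dots,n-1,n$, with an arrow from the left vertex labelled $1$ to $0$ and an arrow from $0$ to the right vertex labelled $1$. Attach to both vertices labelled $1$ the value $u_1u_2$, to each vertex labelled $i\ge3$ the variable $u_i$, and to the vertex $0$ the variable $u_0$, which is set equal to $1$. The result is $\Lambda'$; its vertices are numbered $1,\dots,2n-1$ from left to right, so $u_1u_2$ sits at the $(n-1)$th and $(n+1)$th vertices. The frieze associated with $\Lambda'$ is the frieze of $Q'$ whose initial values (at $k=0$) are these attached values. **Meaning of the inclusion.** The copy of $\bar\omega$ at $k=0$ in $\bar{\mathcal F}$ is identified with the right-hand part $\bar\omega$ of $\Lambda'$; thus the vertex $(k,1)$ of $\bar{\mathcal F}$ corresponds to the vertex $(k,n+1)$ of the frieze of $\Lambda'$ and the vertex $(k,i)$, $3\le i\le n$, corresponds to $(k,n+i-1)$, and values are required to agree. *)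

theory Defs
  imports
    "HOL-Library.FuncSet"
    "HOL-Library.Poly_Mapping"
    "HOL-Computational_Algebra.Fraction_Field"
    "Graph_Theory.Pair_Digraph"
    "Graph_Theory.Digraph_Component"
begin

section \<open>The field of rational functions\<close>

text \<open>
  The fraction field of the polynomial ring over the rationals in countably many independent
  variables. It contains the field of rational functions in the variables
  \<open>indet 1, \<dots>, indet n\<close> for every \<open>n\<close>.
\<close>

type_synonym ratfun = "((nat \<Rightarrow>\<^sub>0 nat) \<Rightarrow>\<^sub>0 rat) fract"

definition indet :: "nat \<Rightarrow> ratfun" where
  "indet i = Fraction_Field.Fract (Poly_Mapping.single (Poly_Mapping.single i 1) 1) 1"


section \<open>Quivers and translation quivers\<close>

text \<open>All quivers that occur are without parallel arrows, so that arrows are pairs of vertices.\<close>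

type_synonym 'v quiver = "'v pair_pre_digraph"

type_synonym ('v, 'f) valued_quiver = "'v quiver \<times> ('v \<Rightarrow> 'f)"

definition translation_quiver :: "'v quiver \<Rightarrow> (int \<times> 'v) quiver" where
  "translation_quiver \<Theta> = \<lparr>
     pverts = UNIV \<times> pverts \<Theta>,
     parcs = {((k, i), (k, j)) | k i j. (i, j) \<in> parcs \<Theta>}
           \<union> {((k, j), (k + 1, i)) | k i j. (i, j) \<in> parcs \<Theta>} \<rparr>"

definition full_subquiver :: "'v quiver \<Rightarrow> 'v set \<Rightarrow> 'v quiver" where
  "full_subquiver G S = \<lparr> pverts = pverts G \<inter> S, parcs = parcs G \<inter> S \<times> S \<rparr>"

definition image_quiver :: "('v \<Rightarrow> 'w) \<Rightarrow> 'v quiver \<Rightarrow> 'w quiver" where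
  "image_quiver f G = \<lparr> pverts = f ` pverts G, parcs = map_prod f f ` parcs G \<rparr>"

definition is_full_valued_subquiver_via ::
    "('v \<Rightarrow> 'w) \<Rightarrow> ('v, 'f) valued_quiver \<Rightarrow> ('w, 'f) valued_quiver \<Rightarrow> bool" where
  "is_full_valued_subquiver_via f F G \<longleftrightarrow>
     inj_on f (pverts (fst F)) \<and>
     induced_subgraph (with_proj (image_quiver f (fst F))) (with_proj (fst G)) \<and>
     (\<forall>v \<in> pverts (fst F). snd G (f v) = snd F v)"


section \<open>Friezes\<close>

text \<open>Value functions are normalised to \<open>undefined\<close> off the vertices.\<close>

definition is_frieze :: "'v quiver \<Rightarrow> ('v \<Rightarrow> 'f) \<Rightarrow> (int \<times> 'v \<Rightarrow> 'f::field) \<Rightarrow> bool" where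
  "is_frieze \<Theta> init a \<longleftrightarrow>
     a \<in> extensional (pverts (translation_quiver \<Theta>)) \<and>
     (\<forall>i \<in> pverts \<Theta>. a (0, i) = init i) \<and>
     (\<forall>k. \<forall>i \<in> pverts \<Theta>.
        a (k, i) * a (k + 1, i)
          = 1 + (\<Prod>e \<in> out_arcs (with_proj (translation_quiver \<Theta>)) (k, i). a (snd e)))"

text \<open>
  The definite description is meaningful for finite acyclic \<open>\<Theta>\<close> whenever the recursion never
  meets the value 0, in particular for initial values which are nonzero and given by
  subtraction-free expressions in independent variables.
\<close>

definition frieze_value :: "'v quiver \<Rightarrow> ('v \<Rightarrow> 'f) \<Rightarrow> (int \<times> 'v \<Rightarrow> 'f::field)" where
  "frieze_value \<Theta> init = (THE a. is_frieze \<Theta> init a)"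

definition frieze :: "'v quiver \<Rightarrow> ('v \<Rightarrow> 'f) \<Rightarrow> (int \<times> 'v, 'f::field) valued_quiver" where
  "frieze \<Theta> init = (translation_quiver \<Theta>, frieze_value \<Theta> init)"


section \<open>Types A and D\<close>

text \<open>Each edge of \<open>E\<close> (a set of two-element sets) carries exactly one of its two orientations.\<close>

definition is_orientation :: "('v \<times> 'v) set \<Rightarrow> 'v set set \<Rightarrow> bool" where
  "is_orientation A E \<longleftrightarrow> bij_betw (\<lambda>(i, j). {i, j}) A E"

definition type_A :: "nat \<Rightarrow> nat quiver \<Rightarrow> bool" where
  "type_A N \<Theta> \<longleftrightarrow> pverts \<Theta> = {1..N} \<and>
     is_orientation (parcs \<Theta>) {{i, i + 1} | i. 1 \<le> i \<and> i < N}"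

definition type_D :: "nat \<Rightarrow> nat quiver \<Rightarrow> bool" where
  "type_D n Q \<longleftrightarrow> pverts Q = {1..n} \<and>
     is_orientation (parcs Q) ({{1, 3}, {2, 3}} \<union> {{i, i + 1} | i. 3 \<le> i \<and> i < n})"

definition fork_enters_joint :: "nat quiver \<Rightarrow> bool" where
  "fork_enters_joint Q \<longleftrightarrow> (1, 3) \<in> parcs Q \<and> (2, 3) \<in> parcs Q"

definition fork_leaves_joint :: "nat quiver \<Rightarrow> bool" where
  "fork_leaves_joint Q \<longleftrightarrow> (3, 1) \<in> parcs Q \<and> (3, 2) \<in> parcs Q"


section \<open>Diagonals and fundamental quivers in type A\<close>

definition south_east :: "nat quiver \<Rightarrow> ((int \<times> nat) \<times> (int \<times> nat)) set" where
  "south_east \<Theta> = {(v, w) \<in> parcs (translation_quiver \<Theta>). snd v = snd w + 1}"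

definition north_east :: "nat quiver \<Rightarrow> ((int \<times> nat) \<times> (int \<times> nat)) set" where
  "north_east \<Theta> = {(v, w) \<in> parcs (translation_quiver \<Theta>). snd w = snd v + 1}"

text \<open>Diagonals are given by the list of the \<open>N\<close> vertices on the path.\<close>

definition descending_diagonal :: "nat \<Rightarrow> nat quiver \<Rightarrow> (int \<times> nat) list \<Rightarrow> bool" where
  "descending_diagonal N \<Theta> d \<longleftrightarrow> length d = N \<and> snd (hd d) = N \<and>
     successively (\<lambda>v w. (v, w) \<in> south_east \<Theta>) d"

definition ascending_diagonal :: "nat \<Rightarrow> nat quiver \<Rightarrow> (int \<times> nat) list \<Rightarrow> bool" where
  "ascending_diagonal N \<Theta> d \<longleftrightarrow> length d = N \<and> snd (hd d) = 1 \<and>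
     successively (\<lambda>v w. (v, w) \<in> north_east \<Theta>) d"

definition fundamental_diagonals ::
    "nat \<Rightarrow> nat quiver \<Rightarrow> int \<Rightarrow> (int \<times> nat) list \<Rightarrow> (int \<times> nat) list \<Rightarrow> bool" where
  "fundamental_diagonals N \<Theta> k0 d1 d2 \<longleftrightarrow> type_A N \<Theta> \<and>
     descending_diagonal N \<Theta> d1 \<and> hd d1 = (k0, N) \<and>
     ascending_diagonal N \<Theta> d2 \<and> last d2 = (k0 + int N, N)"

text \<open>
  Each diagonal meets each of the rows \<open>1, \<dots>, N\<close> exactly once, and within a row the
  first coordinate increases from left to right.
\<close>

definition region_between :: "(int \<times> nat) list \<Rightarrow> (int \<times> nat) list \<Rightarrow> (int \<times> nat) set" where
  "region_between d1 d2 =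
     {(k, j) | k j. \<exists>l r. (l, j) \<in> set d1 \<and> (r, j) \<in> set d2 \<and> l \<le> k \<and> k \<le> r}"

definition fundamental_quiver ::
    "(int \<times> nat, 'f) valued_quiver \<Rightarrow> (int \<times> nat) list \<Rightarrow> (int \<times> nat) list
      \<Rightarrow> (int \<times> nat, 'f) valued_quiver" where
  "fundamental_quiver F d1 d2 = (full_subquiver (fst F) (region_between d1 d2), snd F)"


section \<open>The modelled quiver\<close>

definition merge_fork :: "int \<times> nat \<Rightarrow> int \<times> nat" where
  "merge_fork = (\<lambda>(k, i). (k, if i = 2 then 1 else i))"

definition modelled_quiver ::
    "nat \<Rightarrow> nat quiver \<Rightarrow> (nat \<Rightarrow> 'f) \<Rightarrow> (int \<times> nat, 'f::field) valued_quiver" where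
  "modelled_quiver n Q u =
     (let a = frieze_value Q u in
       (image_quiver merge_fork
          (full_subquiver (translation_quiver Q) ({0..int n} \<times> {1..n})),
        \<lambda>(k, i). if i = 1 then a (k, 1) * a (k, 2) else a (k, i)))"


section \<open>The seed built from two copies of the quiver with one fork vertex removed\<close>

text \<open>
  Positions, in the drawing with labels \<open>n, \<dots>, 4, 3, 1, 0, 1, 3, 4, \<dots>, n\<close> at
  \<open>1, \<dots>, 2n - 1\<close>, of the vertex labelled \<open>i\<close> in the right copy and in the reflected left copy.
\<close>

definition right_pos :: "nat \<Rightarrow> nat \<Rightarrow> nat" where
  "right_pos n i = (if i = 1 then n + 1 else n + i - 1)"

definition left_pos :: "nat \<Rightarrow> nat \<Rightarrow> nat" where
  "left_pos n i = (if i = 1 then n - 1 else n + 1 - i)"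

definition Lambda_quiver :: "nat \<Rightarrow> nat quiver \<Rightarrow> nat quiver" where
  "Lambda_quiver n Q =
     (let \<omega> = full_subquiver Q (- {2});
          L = image_quiver (left_pos n) \<omega>;
          R = image_quiver (right_pos n) \<omega>
      in \<lparr> pverts = pverts L \<union> {n} \<union> pverts R,
           parcs = parcs L \<union> {(n - 1, n), (n, n + 1)} \<union> parcs R \<rparr>)"

text \<open>The value 1 at the central vertex \<open>n\<close> is the specialisation of the variable with index 0.\<close>

definition Lambda_value :: "nat \<Rightarrow> (nat \<Rightarrow> 'f) \<Rightarrow> nat \<Rightarrow> 'f::field" where
  "Lambda_value n u p =
     (if p = n then 1
      else if p = n - 1 \<or> p = n + 1 then u 1 * u 2
      else if p < n then u (n + 1 - p)
      else u (p + 1 - n))"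

definition to_Lambda :: "nat \<Rightarrow> int \<times> nat \<Rightarrow> int \<times> nat" where
  "to_Lambda n = (\<lambda>(k, i). (k, right_pos n i))"

end

(* In type A the frieze relation becomes c i j * c (i+1) (j+1) = 1 + c (i+1) j * c i (j+1) in
   coordinates adapted to the diagonals, and it is the Pluecker relation for
   c i j = det (x i, x j) with det (x i, x (i+1)) = 1. For the seed Lambda' such plane vectors can be
   written down: the right half of the seed is a triangulation of the polygon with vertices
   0, ..., n and fixes x 0, ..., x n; the mirror symmetry of the seed and u_0 = 1 then force
   x (i+n) = T (x i) for 0 <= i <= n, where det T = 1 and trace T = 2. The trace gives
   c i (i+n+1) = 2 + c (i+1) (i+n), so that the relation in the row of u_1 u_2 reads
   c i (i+n) * c (i+1) (i+n+1) = (1 + c (i+1) (i+n))^2. This is the relation satisfied by the product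
   of the values at the two fork vertices in type D, and all other relations of the two friezes
   coincide. As the values are subtraction-free, hence nonzero, the relations determine them. *)

theory Submission
  imports Defs
begin

section \<open>Subtraction-free rational functions\<close>

text \<open>Why the trace is 2: the array belongs to a polygon with 2n+2 vertices, where x (i+2n+2)
  = - x i. The two halves of the seed put the same values on the subpolygons 0, ..., n and n, ...,
  2n, so a linear map T of determinant 1 carries the first to the second and x 0 to x n. With x 0 =
  (1, 0), x n = (0, P) and P = u_1 u_2, this fixes all entries of T except its trace d. The last
  vertex 2n+1 is adjacent to 2n and 0, and its diagonal to n has value u_0. Hence x (2n+1) = (- u_0
  / P, 1), and det (x (2n), x (2n+1)) = 1 reads d u_0 - 1 = 1, so d = 2 / u_0. In the fork row the
  relation has right-hand side 1 + y (y + d), a square for d = 2. Two obstacles shape the proof.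
  Determinants involve subtraction, so their nonvanishing is not visible; they are therefore
  compared with a positive frieze built by recursion. And T relates x i to x (i+n) for 0 <= i <= n
  only, so the trace identity covers exactly the n steps from slice 0 to slice n of the modelled
  quiver.\<close>

definition positive_polys :: "((nat \<Rightarrow>\<^sub>0 nat) \<Rightarrow>\<^sub>0 rat) set" where
  "positive_polys = {p. p \<noteq> 0 \<and> (\<forall>m. 0 \<le> Poly_Mapping.lookup p m)}"

text \<open>Contains every subtraction-free expression in the variables. Membership is decided by
  coefficients, so no syntax for such expressions is required.\<close>

definition positive_ratfuns :: "ratfun set" where
  "positive_ratfuns = {Fraction_Field.Fract p q | p q. p \<in> positive_polys \<and> q \<in> positive_polys}"

text \<open>Nonnegative coefficients cannot cancel, so a nonzero coefficient of \<open>p\<close>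
  survives in the sum.\<close>

lemma positive_polys_add:
  assumes "p \<in> positive_polys" "q \<in> positive_polys"
  shows "p + q \<in> positive_polys"
proof -
  obtain m where m: "Poly_Mapping.lookup p m \<noteq> 0"
    using assms(1) unfolding positive_polys_def
    by (metis (mono_tags, lifting) lookup_zero mem_Collect_eq poly_mapping_eqI)
  have nonneg: "0 \<le> Poly_Mapping.lookup p l" "0 \<le> Poly_Mapping.lookup q l" for l
    using assms by (auto simp: positive_polys_def)
  have "Poly_Mapping.lookup (p + q) m \<noteq> 0"
    using nonneg[of m] m by (simp add: lookup_add add_nonneg_eq_0_iff)
  then have "p + q \<noteq> 0" by auto
  then show ?thesis using nonneg by (simp add: positive_polys_def lookup_add)
qed

lemma positive_polys_mult:
  assumes "p \<in> positive_polys" "q \<in> positive_polys"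
  shows "p * q \<in> positive_polys"
proof -
  have nonneg: "0 \<le> Poly_Mapping.lookup p l" "0 \<le> Poly_Mapping.lookup q l" for l
    using assms by (auto simp: positive_polys_def)
  have "0 \<le> Poly_Mapping.lookup (p * q) m" for m
    unfolding lookup_mult Sum_any.expand_set
    by (intro sum_nonneg mult_nonneg_nonneg) (auto simp: when_def nonneg)
  then show ?thesis using assms by (simp add: positive_polys_def)
qed

lemma positive_ratfuns_arith:
  assumes "x \<in> positive_ratfuns" "y \<in> positive_ratfuns"
  shows positive_ratfuns_add: "x + y \<in> positive_ratfuns"
    and positive_ratfuns_mult: "x * y \<in> positive_ratfuns"
    and positive_ratfuns_divide: "x / y \<in> positive_ratfuns"
proof -
  obtain p q p' q' where x: "x = Fraction_Field.Fract p q" and y: "y = Fraction_Field.Fract p' q'"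
    and pos: "p \<in> positive_polys" "q \<in> positive_polys" "p' \<in> positive_polys" "q' \<in> positive_polys"
    using assms by (auto simp: positive_ratfuns_def)
  have "q \<noteq> 0" "q' \<noteq> 0" using pos by (auto simp: positive_polys_def)
  then have "x + y = Fraction_Field.Fract (p * q' + p' * q) (q * q')"
    "x * y = Fraction_Field.Fract (p * p') (q * q')"
    "x / y = Fraction_Field.Fract (p * q') (q * p')"
    by (simp_all add: x y)
  then show "x + y \<in> positive_ratfuns" "x * y \<in> positive_ratfuns" "x / y \<in> positive_ratfuns"
    using pos unfolding positive_ratfuns_def
    by (blast intro: positive_polys_add positive_polys_mult)+
qed

lemma zero_notin_positive_ratfuns: "0 \<notin> positive_ratfuns"
  by (auto simp: positive_ratfuns_def positive_polys_def Zero_fract_def eq_fract)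

lemma single_in_positive_polys: "Poly_Mapping.single m 1 \<in> positive_polys"
proof -
  have "Poly_Mapping.lookup (Poly_Mapping.single m (1::rat)) m \<noteq> 0" by simp
  then have "Poly_Mapping.single m (1::rat) \<noteq> 0" by (metis lookup_zero)
  then show ?thesis by (simp add: positive_polys_def lookup_single when_def)
qed

lemma indet_in_positive_ratfuns: "indet i \<in> positive_ratfuns"
proof -
  have "1 \<in> positive_polys" using single_in_positive_polys[of 0] by simp
  then show ?thesis
    unfolding indet_def positive_ratfuns_def using single_in_positive_polys by blast
qed

lemma one_in_positive_ratfuns: "1 \<in> positive_ratfuns"
proof -
  have "1 \<in> positive_polys" using single_in_positive_polys[of 0] by simp
  then show ?thesis unfolding One_fract_def positive_ratfuns_def by blast
qed


section \<open>Existence and uniqueness of friezes\<close>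

text \<open>What the frieze recursion asks of its values: it divides by earlier values, so these
  must stay in a set without 0. The abstraction keeps polynomials out of the rest of the
  argument.\<close>

locale semifield_cone =
  fixes C :: "'f::field set"
  assumes one_mem: "1 \<in> C"
    and zero_notin: "0 \<notin> C"
    and add_mem: "\<And>x y. x \<in> C \<Longrightarrow> y \<in> C \<Longrightarrow> x + y \<in> C"
    and mult_mem: "\<And>x y. x \<in> C \<Longrightarrow> y \<in> C \<Longrightarrow> x * y \<in> C"
    and divide_mem: "\<And>x y. x \<in> C \<Longrightarrow> y \<in> C \<Longrightarrow> x / y \<in> C"
begin

lemma prod_mem: "(\<And>i. i \<in> I \<Longrightarrow> f i \<in> C) \<Longrightarrow> prod f I \<in> C"
  by (induction I rule: infinite_finite_induct) (auto intro: one_mem mult_mem)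

text \<open>The new value at \<open>i\<close> needs the old slice and the new values at sources of
  arrows into \<open>i\<close>; well-founded recursion along \<open>A\<close> therefore computes
  it.\<close>

lemma next_slice:
  assumes "finite A" "acyclic A" "\<And>i. s i \<in> C"
  shows "\<exists>s'. (\<forall>i. s' i \<in> C) \<and>
    (\<forall>i. s i * s' i = 1 + (\<Prod>j\<in>A `` {i}. s j) * (\<Prod>j\<in>A\<inverse> `` {i}. s' j))"
proof -
  define F where "F = (\<lambda>s' i. (1 + (\<Prod>j\<in>A `` {i}. s j) * (\<Prod>j\<in>A\<inverse> `` {i}. s' j)) / s i)"
  have wf: "wf A" using assms by (simp add: finite_acyclic_wf)
  define s' where "s' = wfrec A F"
  have rec: "s' i = F s' i" for i
  proof -
    have "s' i = F (cut s' A i) i" unfolding s'_def by (subst wfrec[OF wf]) simp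
    also have "\<dots> = F s' i" unfolding F_def by (simp add: cut_def)
    finally show ?thesis .
  qed
  have "s' i \<in> C" for i
    using wf
  proof (induction i rule: wf_induct_rule)
    case (less i)
    then show ?case unfolding rec[of i] F_def
      by (intro divide_mem add_mem one_mem mult_mem prod_mem) (auto simp: assms)
  qed
  moreover have "s i * s' i = 1 + (\<Prod>j\<in>A `` {i}. s j) * (\<Prod>j\<in>A\<inverse> `` {i}. s' j)" for i
  proof -
    have "s i \<noteq> 0" using assms(3) zero_notin by metis
    then show ?thesis unfolding rec[of i] by (simp add: F_def)
  qed
  ultimately show ?thesis by blast
qed

lemma slice_sequence:
  assumes "finite A" "acyclic A" "\<And>i. s i \<in> C"
  obtains f :: "nat \<Rightarrow> 'v \<Rightarrow> 'f" where "f 0 = s" "\<And>k i. f k i \<in> C"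
    "\<And>k i. f k i * f (Suc k) i = 1 + (\<Prod>j\<in>A `` {i}. f k j) * (\<Prod>j\<in>A\<inverse> `` {i}. f (Suc k) j)"
proof -
  have "\<exists>f. \<forall>k. ((\<forall>i. f k i \<in> C) \<and> (k = 0 \<longrightarrow> f k = s)) \<and>
    (\<forall>i. f k i * f (Suc k) i = 1 + (\<Prod>j\<in>A `` {i}. f k j) * (\<Prod>j\<in>A\<inverse> `` {i}. f (Suc k) j))"
    by (rule dependent_nat_choice) (use assms next_slice[OF assms(1,2)] in auto)
  then show ?thesis using that by metis
qed

end

section \<open>Friezes of finite acyclic quivers\<close>

lemma translation_quiver_prod:
  assumes "finite (parcs \<Theta>)"
  shows "(\<Prod>e\<in>out_arcs (with_proj (translation_quiver \<Theta>)) (k, i). a (snd e)) =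
    (\<Prod>j\<in>parcs \<Theta> `` {i}. a (k, j)) * (\<Prod>j\<in>(parcs \<Theta>)\<inverse> `` {i}. a (k + 1, j))"
proof -
  let ?X = "(\<lambda>j. ((k, i), (k, j))) ` (parcs \<Theta> `` {i})"
  let ?Y = "(\<lambda>j. ((k, i), (k + 1, j))) ` ((parcs \<Theta>)\<inverse> `` {i})"
  have fin: "finite (parcs \<Theta> `` {i})" "finite ((parcs \<Theta>)\<inverse> `` {i})"
    using assms by (auto intro: finite_Image)
  have "out_arcs (with_proj (translation_quiver \<Theta>)) (k, i) = ?X \<union> ?Y"
    by (auto simp: out_arcs_def translation_quiver_def)
  then have "(\<Prod>e\<in>out_arcs (with_proj (translation_quiver \<Theta>)) (k, i). a (snd e)) =
      (\<Prod>e\<in>?X. a (snd e)) * (\<Prod>e\<in>?Y. a (snd e))"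
    using fin by (simp, subst prod.union_disjoint) auto
  then show ?thesis by (simp add: prod.reindex inj_on_def)
qed

locale acyclic_quiver =
  fixes \<Theta> :: "'v quiver"
  assumes finite_arcs: "finite (parcs \<Theta>)"
    and acyclic_arcs: "acyclic (parcs \<Theta>)"
    and arcs_subset: "parcs \<Theta> \<subseteq> pverts \<Theta> \<times> pverts \<Theta>"
begin

lemma is_frieze_iff:
  "is_frieze \<Theta> init a \<longleftrightarrow> a \<in> extensional (UNIV \<times> pverts \<Theta>) \<and>
     (\<forall>i\<in>pverts \<Theta>. a (0, i) = init i) \<and>
     (\<forall>k. \<forall>i\<in>pverts \<Theta>. a (k, i) * a (k + 1, i) =
        1 + (\<Prod>j\<in>parcs \<Theta> `` {i}. a (k, j)) * (\<Prod>j\<in>(parcs \<Theta>)\<inverse> `` {i}. a (k + 1, j)))"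
  unfolding is_frieze_def translation_quiver_prod[OF finite_arcs]
  by (simp add: translation_quiver_def)

lemma frieze_exists:
  assumes "semifield_cone C" and init: "\<And>i. i \<in> pverts \<Theta> \<Longrightarrow> init i \<in> C"
  obtains a where "is_frieze \<Theta> init a" "\<And>k i. i \<in> pverts \<Theta> \<Longrightarrow> a (k, i) \<in> C"
proof -
  interpret semifield_cone C by fact
  let ?A = "parcs \<Theta>"
  \<comment> \<open>The default 1 off the vertices lies in the cone, as
    \<open>slice_sequence\<close> works with total functions.\<close>
  define s where "s i = (if i \<in> pverts \<Theta> then init i else 1)" for i
  have s: "s i \<in> C" for i using init one_mem by (simp add: s_def)
  obtain f :: "nat \<Rightarrow> 'v \<Rightarrow> 'a" where f: "f 0 = s" "\<And>k i. f k i \<in> C"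
    "\<And>k i. f k i * f (Suc k) i = 1 + (\<Prod>j\<in>?A `` {i}. f k j) * (\<Prod>j\<in>?A\<inverse> `` {i}. f (Suc k) j)"
    by (rule slice_sequence[of ?A s]) (use finite_arcs acyclic_arcs s in simp_all)
  \<comment> \<open>Decreasing \<open>k\<close> exchanges incoming and outgoing arrows, so the
    negative slices are forward slices of the opposite quiver.\<close>
  obtain h :: "nat \<Rightarrow> 'v \<Rightarrow> 'a" where h: "h 0 = s" "\<And>k i. h k i \<in> C"
    "\<And>k i. h k i * h (Suc k) i = 1 + (\<Prod>j\<in>?A\<inverse> `` {i}. h k j) * (\<Prod>j\<in>?A `` {i}. h (Suc k) j)"
    by (rule slice_sequence[of "?A\<inverse>" s]) (use finite_arcs acyclic_arcs s in simp_all)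
  define a where "a = restrict (\<lambda>(k, i). if k \<ge> 0 then f (nat k) i else h (nat (- k)) i)
    (UNIV \<times> pverts \<Theta>)"
  have a_nonneg: "a (k, i) = f (nat k) i" if "k \<ge> 0" "i \<in> pverts \<Theta>" for k i
    using that by (simp add: a_def)
  have a_nonpos: "a (k, i) = h (nat (- k)) i" if "k \<le> 0" "i \<in> pverts \<Theta>" for k i
    using that f(1) h(1) by (cases "k = 0") (simp_all add: a_def)
  have ends: "i \<in> pverts \<Theta>" "j \<in> pverts \<Theta>" if "(i, j) \<in> ?A" for i j
    using arcs_subset that by auto
  have "a (k, i) * a (k + 1, i) =
      1 + (\<Prod>j\<in>?A `` {i}. a (k, j)) * (\<Prod>j\<in>?A\<inverse> `` {i}. a (k + 1, j))"
    if i: "i \<in> pverts \<Theta>" for k i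
  proof (cases "k \<ge> 0")
    case True
    then have "nat (k + 1) = Suc (nat k)" by simp
    moreover have "(\<Prod>j\<in>?A `` {i}. a (k, j)) = (\<Prod>j\<in>?A `` {i}. f (nat k) j)"
      using True ends by (intro prod.cong) (auto simp: a_nonneg)
    moreover have "(\<Prod>j\<in>?A\<inverse> `` {i}. a (k + 1, j)) = (\<Prod>j\<in>?A\<inverse> `` {i}. f (nat (k + 1)) j)"
      using True ends by (intro prod.cong) (auto simp: a_nonneg)
    ultimately show ?thesis using f(3)[of "nat k" i] True i by (simp add: a_nonneg)
  next
    case False
    then have "nat (- k) = Suc (nat (- (k + 1)))" by simp
    moreover have "(\<Prod>j\<in>?A `` {i}. a (k, j)) = (\<Prod>j\<in>?A `` {i}. h (nat (- k)) j)"
      using False ends by (intro prod.cong) (auto simp: a_nonpos)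
    moreover have "(\<Prod>j\<in>?A\<inverse> `` {i}. a (k + 1, j)) = (\<Prod>j\<in>?A\<inverse> `` {i}. h (nat (- (k + 1))) j)"
      using False ends by (intro prod.cong) (auto simp: a_nonpos)
    ultimately show ?thesis using h(3)[of "nat (- (k + 1))" i] False i
      by (simp add: a_nonpos mult.commute)
  qed
  then have "is_frieze \<Theta> init a"
    by (auto simp: is_frieze_iff a_nonneg f(1) s_def) (simp add: a_def)
  moreover have "a (k, i) \<in> C" if "i \<in> pverts \<Theta>" for k i
    using that f(2) h(2) by (simp add: a_def)
  ultimately show ?thesis using that by blast
qed

text \<open>The step hypothesis speaks of equal products and not of friezes, because the lemma also
  serves for merged fork values, which obey another relation at the fork. Cancelling the old value,
  equal to a nonzero value of \<open>b\<close>, gives the new one. The bound \<open>K\<close> is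
  there because the fork relation is available for finitely many slices.\<close>

lemma slices_agree:
  fixes a b :: "int \<times> 'v \<Rightarrow> 'f::field"
  assumes nz: "\<And>k i. i \<in> pverts \<Theta> \<Longrightarrow> b (k, i) \<noteq> 0"
    and init: "\<And>i. i \<in> pverts \<Theta> \<Longrightarrow> a (0, i) = b (0, i)"
    and step: "\<And>k i. 0 \<le> k \<Longrightarrow> k < K \<Longrightarrow> i \<in> pverts \<Theta> \<Longrightarrow>
      (\<And>j. (i, j) \<in> parcs \<Theta> \<Longrightarrow> a (k, j) = b (k, j)) \<Longrightarrow>
      (\<And>j. (j, i) \<in> parcs \<Theta> \<Longrightarrow> a (k + 1, j) = b (k + 1, j)) \<Longrightarrow>
      a (k, i) * a (k + 1, i) = b (k, i) * b (k + 1, i)"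
    and "0 \<le> k" "k \<le> K" "i \<in> pverts \<Theta>"
  shows "a (k, i) = b (k, i)"
  using assms(4-6)
proof (induction k arbitrary: i rule: int_ge_induct)
  case base
  then show ?case using init by simp
next
  case (step k)
  have "wf (parcs \<Theta>)" by (simp add: finite_acyclic_wf finite_arcs acyclic_arcs)
  then show ?case using \<open>i \<in> pverts \<Theta>\<close>
  proof (induction i rule: wf_induct_rule)
    case (less i)
    have "a (k, i) * a (k + 1, i) = b (k, i) * b (k + 1, i)"
      using step less arcs_subset by (intro assms(3)) auto
    then show ?case using step.IH[of i] step.prems less.prems nz[of i k] by simp
  qed
qed

lemma converse_acyclic_quiver: "acyclic_quiver (\<Theta>\<lparr>parcs := (parcs \<Theta>)\<inverse>\<rparr>)"
  using arcs_subset by unfold_locales (auto simp: finite_arcs acyclic_arcs)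

text \<open>Nonvanishing is asked of one frieze alone. Thus a frieze of determinants can be
  identified with the positive one before anything is known about its zeros.\<close>

lemma frieze_unique:
  fixes a b :: "int \<times> 'v \<Rightarrow> 'f::field"
  assumes a: "is_frieze \<Theta> init a" and b: "is_frieze \<Theta> init b"
    and nz: "\<And>k i. i \<in> pverts \<Theta> \<Longrightarrow> b (k, i) \<noteq> 0"
  shows "a = b"
proof (rule extensionalityI[of _ "UNIV \<times> pverts \<Theta>"])
  fix v :: "int \<times> 'v" assume "v \<in> UNIV \<times> pverts \<Theta>"
  then obtain k i where v: "v = (k, i)" and i: "i \<in> pverts \<Theta>" by auto
  interpret op: acyclic_quiver "\<Theta>\<lparr>parcs := (parcs \<Theta>)\<inverse>\<rparr>"
    by (rule converse_acyclic_quiver)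
  have init: "a (0, i) = b (0, i)" if "i \<in> pverts \<Theta>" for i
    using a b that by (simp add: is_frieze_iff)
  have step: "a (k, i) * a (k + 1, i) = b (k, i) * b (k + 1, i)" if "i \<in> pverts \<Theta>"
    "\<And>j. (i, j) \<in> parcs \<Theta> \<Longrightarrow> a (k, j) = b (k, j)"
    "\<And>j. (j, i) \<in> parcs \<Theta> \<Longrightarrow> a (k + 1, j) = b (k + 1, j)" for k i
    using a b that by (simp add: is_frieze_iff)
  show "a v = b v"
  proof (cases "0 \<le> k")
    case True
    show ?thesis unfolding v
      by (rule slices_agree[of b a k]) (use nz init step True i in auto)
  next
    case False
    \<comment> \<open>Reversing the sign of \<open>k\<close> turns a frieze into one of the opposite
      quiver, which reduces negative slices to the case already treated.\<close>
    have "(\<lambda>(k, i). a (- k, i)) (- k, i) = (\<lambda>(k, i). b (- k, i)) (- k, i)"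
    proof (rule op.slices_agree[where K = "- k"])
      fix k' i assume "i \<in> pverts (\<Theta>\<lparr>parcs := (parcs \<Theta>)\<inverse>\<rparr>)"
        and out: "\<And>j. (i, j) \<in> parcs (\<Theta>\<lparr>parcs := (parcs \<Theta>)\<inverse>\<rparr>) \<Longrightarrow>
          (case (k', j) of (k, i) \<Rightarrow> a (- k, i)) = (case (k', j) of (k, i) \<Rightarrow> b (- k, i))"
        and into: "\<And>j. (j, i) \<in> parcs (\<Theta>\<lparr>parcs := (parcs \<Theta>)\<inverse>\<rparr>) \<Longrightarrow>
          (case (k' + 1, j) of (k, i) \<Rightarrow> a (- k, i)) = (case (k' + 1, j) of (k, i) \<Rightarrow> b (- k, i))"
      then show "(case (k', i) of (k, i) \<Rightarrow> a (- k, i)) * (case (k' + 1, i) of (k, i) \<Rightarrow> a (- k, i)) =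
        (case (k', i) of (k, i) \<Rightarrow> b (- k, i)) * (case (k' + 1, i) of (k, i) \<Rightarrow> b (- k, i))"
        using step[of i "- (k' + 1)"] by (simp add: mult.commute)
    qed (use nz init False i in auto)
    then show ?thesis by (simp add: v)
  qed
qed (use a b in \<open>auto simp: is_frieze_iff\<close>)

lemma frieze_value_eq:
  fixes b :: "int \<times> 'v \<Rightarrow> 'f::field"
  assumes "is_frieze \<Theta> init b" "\<And>k i. i \<in> pverts \<Theta> \<Longrightarrow> b (k, i) \<noteq> 0"
  shows "frieze_value \<Theta> init = b"
  unfolding frieze_value_def using assms frieze_unique by blast

lemma frieze_value_positive:
  assumes "semifield_cone C" "\<And>i. i \<in> pverts \<Theta> \<Longrightarrow> init i \<in> C"
  shows "is_frieze \<Theta> init (frieze_value \<Theta> init)"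
    and "\<And>k i. i \<in> pverts \<Theta> \<Longrightarrow> frieze_value \<Theta> init (k, i) \<in> C"
proof -
  obtain a where a: "is_frieze \<Theta> init a" "\<And>k i. i \<in> pverts \<Theta> \<Longrightarrow> a (k, i) \<in> C"
    using frieze_exists[of C init] assms by blast
  then have "a (k, i) \<noteq> 0" if "i \<in> pverts \<Theta>" for k i
    using semifield_cone.zero_notin[OF assms(1)] that by metis
  then have "frieze_value \<Theta> init = a" by (intro frieze_value_eq a)
  then show "is_frieze \<Theta> init (frieze_value \<Theta> init)"
    and "\<And>k i. i \<in> pverts \<Theta> \<Longrightarrow> frieze_value \<Theta> init (k, i) \<in> C" using a by simp_all
qed

end


section \<open>Arrays of determinants\<close>

definition det2 :: "'f \<times> 'f \<Rightarrow> 'f \<times> 'f \<Rightarrow> 'f::field" where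
  "det2 x y = fst x * snd y - snd x * fst y"

lemma det2_pluecker:
  "det2 x y * det2 x' y' = det2 x x' * det2 y y' + det2 x' y * det2 x y'"
  by (simp add: det2_def algebra_simps)

lemma det2_self: "det2 x x = 0"
  by (simp add: det2_def)

lemma det2_combination:
  "det2 x ((fst y + s * fst w) / d, (snd y + s * snd w) / d) = (det2 x y + s * det2 x w) / d"
  "det2 ((fst y + s * fst w) / d, (snd y + s * snd w) / d) x = (det2 y x + s * det2 w x) / d"
  by (cases "d = 0"; simp add: det2_def field_simps)+

text \<open>
  The pairs \<open>(\<gamma> t, \<gamma> t + m - t + 1)\<close> are the sides and diagonals of a triangulation of the
  polygon with vertices \<open>\<gamma> 0, \<dots>, \<gamma> 0 + m + 1\<close> that has no internal triangle.
\<close>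

lemma vectors_along_zigzag:
  fixes \<gamma> :: "nat \<Rightarrow> int" and v :: "nat \<Rightarrow> 'f::field"
  assumes "\<And>t. t < m \<Longrightarrow> \<gamma> (Suc t) = \<gamma> t \<or> \<gamma> (Suc t) = \<gamma> t + 1"
    and "\<And>t. t \<le> m \<Longrightarrow> v t \<noteq> 0" "v m = 1" "det2 X Y = v 0"
  shows "\<exists>x. x (\<gamma> 0) = X \<and> x (\<gamma> 0 + int m + 1) = Y \<and>
    (\<forall>i\<in>{\<gamma> 0..\<gamma> 0 + int m}. det2 (x i) (x (i + 1)) = 1) \<and>
    (\<forall>t\<le>m. det2 (x (\<gamma> t)) (x (\<gamma> t + int m - int t + 1)) = v t)"
  using assms
proof (induction m arbitrary: \<gamma> v X Y)
  case 0
  show ?case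
    by (rule exI[of _ "\<lambda>i. if i = \<gamma> 0 then X else Y"]) (use 0 in auto)
next
  case (Suc m)
  have nz: "v 0 \<noteq> 0" using Suc.prems by simp
  have split: "(\<forall>t\<le>Suc m. R t) \<longleftrightarrow> R 0 \<and> (\<forall>t\<le>m. R (Suc t))" for R
    by (metis le_SucE le_Suc_eq not0_implies_Suc Suc_le_mono zero_le)
  \<comment> \<open>The third vertex of the triangle on the outermost diagonal \<open>X\<close>,
    \<open>Y\<close>: adjacent to \<open>Y\<close> if the left end of the next diagonal stays,
    adjacent to \<open>X\<close> if it moves. Its determinants with \<open>X\<close> and
    \<open>Y\<close> are prescribed as 1 and \<open>v 1\<close>, in the order given by the case, and
    \<open>det2 X Y = v 0\<close> is nonzero, so Cramer's rule gives \<open>Z\<close>. The induction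
    continues with the polygon that remains after this triangle is cut off.\<close>
  define Z where "Z = (if \<gamma> 1 = \<gamma> 0
    then ((fst X + v 1 * fst Y) / v 0, (snd X + v 1 * snd Y) / v 0)
    else ((fst Y + v 1 * fst X) / v 0, (snd Y + v 1 * snd X) / v 0))"
  \<comment> \<open>Keeps the diagonals of the smaller polygon inside it, so that adding the vertex
    that was cut off changes none of their end points.\<close>
  have gen: "t \<le> m \<Longrightarrow> \<gamma> 1 \<le> \<gamma> (Suc t) \<and> \<gamma> (Suc t) \<le> \<gamma> 1 + int t" for t
  proof (induction t)
    case (Suc t)
    then show ?case using Suc.prems \<open>\<And>t. t < Suc m \<Longrightarrow> \<gamma> (Suc t) = \<gamma> t \<or> \<gamma> (Suc t) = \<gamma> t + 1\<close>[of "Suc t"]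
      by fastforce
  qed simp
  show ?case
  proof (cases "\<gamma> 1 = \<gamma> 0")
    case True
    have Z: "det2 X Z = v 1" "det2 Z Y = 1"
      using True nz Suc.prems(4)
      by (simp_all add: Z_def det2_combination det2_self)
    obtain x where x: "x (\<gamma> 1) = X" "x (\<gamma> 1 + int m + 1) = Z"
      "\<forall>i\<in>{\<gamma> 1..\<gamma> 1 + int m}. det2 (x i) (x (i + 1)) = 1"
      "\<forall>t\<le>m. det2 (x (\<gamma> (Suc t))) (x (\<gamma> (Suc t) + int m - int t + 1)) = v (Suc t)"
      using Suc.IH[of "\<lambda>t. \<gamma> (Suc t)" "\<lambda>t. v (Suc t)" X Z] Suc.prems Z by auto
    define x' where "x' = x(\<gamma> 0 + int m + 2 := Y)"
    have old: "x' i = x i" if "i < \<gamma> 0 + int m + 2" for i using that by (simp add: x'_def)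
    have new: "x' (\<gamma> 0 + int m + 2) = Y" by (simp add: x'_def)
    have "det2 (x' i) (x' (i + 1)) = 1" if "i \<in> {\<gamma> 0..\<gamma> 0 + int (Suc m)}" for i
    proof (cases "i = \<gamma> 0 + int m + 1")
      case True
      then show ?thesis using new old[of i] x(2) Z(2) \<open>\<gamma> 1 = \<gamma> 0\<close> by (simp add: algebra_simps)
    next
      case False
      then have "i \<in> {\<gamma> 1..\<gamma> 1 + int m}" using that True by auto
      then show ?thesis using x(3) True old[of i] old[of "i + 1"] by simp
    qed
    moreover have "det2 (x' (\<gamma> (Suc t))) (x' (\<gamma> (Suc t) + int m - int t + 1)) = v (Suc t)"
      if "t \<le> m" for t
      using x(4) that gen[OF that] True by (simp add: old)
    moreover have "x' (\<gamma> 0) = X" using x(1) True by (simp add: old)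
    ultimately show ?thesis
      by (intro exI[of _ x'], unfold split) (use new Suc.prems(4) in \<open>simp add: algebra_simps\<close>)
  next
    case False
    then have g1: "\<gamma> 1 = \<gamma> 0 + 1" using Suc.prems(1)[of 0] by auto
    have Z: "det2 X Z = 1" "det2 Z Y = v 1"
      using False nz Suc.prems(4)
      by (simp_all add: Z_def det2_combination det2_self)
    obtain x where x: "x (\<gamma> 1) = Z" "x (\<gamma> 1 + int m + 1) = Y"
      "\<forall>i\<in>{\<gamma> 1..\<gamma> 1 + int m}. det2 (x i) (x (i + 1)) = 1"
      "\<forall>t\<le>m. det2 (x (\<gamma> (Suc t))) (x (\<gamma> (Suc t) + int m - int t + 1)) = v (Suc t)"
      using Suc.IH[of "\<lambda>t. \<gamma> (Suc t)" "\<lambda>t. v (Suc t)" Z Y] Suc.prems Z by auto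
    define x' where "x' = x(\<gamma> 0 := X)"
    have old: "x' i = x i" if "i > \<gamma> 0" for i using that by (simp add: x'_def)
    have new: "x' (\<gamma> 0) = X" by (simp add: x'_def)
    have last: "x' (\<gamma> 0 + int m + 2) = Y" using x(2) g1 by (simp add: old algebra_simps)
    have "det2 (x' i) (x' (i + 1)) = 1" if "i \<in> {\<gamma> 0..\<gamma> 0 + int (Suc m)}" for i
    proof (cases "i = \<gamma> 0")
      case True
      then show ?thesis using new old[of "i + 1"] x(1) Z(1) g1 by simp
    next
      case False
      then have "i \<in> {\<gamma> 1..\<gamma> 1 + int m}" using that g1 by auto
      then show ?thesis using x(3) g1 old[of i] old[of "i + 1"] by simp
    qed
    moreover have "det2 (x' (\<gamma> (Suc t))) (x' (\<gamma> (Suc t) + int m - int t + 1)) = v (Suc t)"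
      if "t \<le> m" for t
      using x(4) that gen[OF that] g1 by (simp add: old)
    ultimately show ?thesis
      by (intro exI[of _ x'], unfold split) (use new last Suc.prems(4) in \<open>simp add: algebra_simps\<close>)
  qed
qed

text \<open>
  The vectors below satisfy \<open>x (i + n) = T (x i)\<close> for \<open>0 \<le> i \<le> n\<close>, where the linear map \<open>T\<close> has
  determinant 1 and trace 2. The trace is what gives the last clause.
\<close>

lemma symmetric_array:
  fixes \<gamma> :: "nat \<Rightarrow> int" and v :: "nat \<Rightarrow> 'f::field"
  assumes "n \<ge> 1" and "\<gamma> 0 = 0"
    and "\<And>t. Suc t < n \<Longrightarrow> \<gamma> (Suc t) = \<gamma> t \<or> \<gamma> (Suc t) = \<gamma> t + 1"
    and "\<And>t. t < n \<Longrightarrow> v t \<noteq> 0" "v (n - 1) = 1"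
  obtains c :: "int \<Rightarrow> int \<Rightarrow> 'f" where
    "\<And>i j. c i j * c (i + 1) (j + 1) = 1 + c (i + 1) j * c i (j + 1)"
    "\<And>i. c i (i + 1) = 1" "\<And>i. c i (i + 2 * int n + 1) = 1"
    "\<And>t. t < n \<Longrightarrow> c (\<gamma> t) (\<gamma> t + int n - int t) = v t"
    "c (- 1) (int n) = 1"
    "\<And>t. t < n \<Longrightarrow> c (\<gamma> t - 2 - int t) (\<gamma> t + int n) = v t"
    "\<And>i. 0 \<le> i \<Longrightarrow> i < int n \<Longrightarrow> c i (i + int n + 1) = 2 + c (i + 1) (i + int n)"
proof -
  define N where "N = int n"
  have N: "N \<ge> 1" using assms(1) by (simp add: N_def)
  define P where "P = v 0"
  have P: "P \<noteq> 0" using assms(1,4) by (simp add: P_def)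
  \<comment> \<open>A normalisation of coordinates: the outermost diagonal must have determinant
    \<open>v 0 = P\<close>.\<close>
  obtain x where x: "x 0 = (1, 0)" "x N = (0, P)"
    "\<And>i. 0 \<le> i \<Longrightarrow> i < N \<Longrightarrow> det2 (x i) (x (i + 1)) = 1"
    "\<And>t. t < n \<Longrightarrow> det2 (x (\<gamma> t)) (x (\<gamma> t + N - int t)) = v t"
  proof -
    have "\<exists>x. x (\<gamma> 0) = (1, 0) \<and> x (\<gamma> 0 + int (n - 1) + 1) = (0, P) \<and>
      (\<forall>i\<in>{\<gamma> 0..\<gamma> 0 + int (n - 1)}. det2 (x i) (x (i + 1)) = 1) \<and>
      (\<forall>t\<le>n - 1. det2 (x (\<gamma> t)) (x (\<gamma> t + int (n - 1) - int t + 1)) = v t)"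
      by (rule vectors_along_zigzag) (use assms in \<open>auto simp: det2_def P_def\<close>)
    then obtain x where x: "x 0 = (1, 0)" "x N = (0, P)"
      "\<forall>i\<in>{0..N - 1}. det2 (x i) (x (i + 1)) = 1"
      "\<forall>t\<le>n - 1. det2 (x (\<gamma> t)) (x (\<gamma> t + (N - 1) - int t + 1)) = v t"
      using assms(1,2) by (auto simp: N_def of_nat_diff)
    have "det2 (x (\<gamma> t)) (x (\<gamma> t + N - int t)) = v t" if "t < n" for t
      using x(4)[rule_format, of t] that by (simp add: algebra_simps)
    then show ?thesis using that x by simp
  qed
  \<comment> \<open>The first column says that (1, 0) goes to (0, P), the entry
    \<open>- 1 / P\<close> makes the determinant 1, and the entry 2, equal to the trace, encodes the
    central value 1.\<close>
  define T where "T w = (- snd w / P, P * fst w + 2 * snd w)" for w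
  have T: "det2 (T w) (T w') = det2 w w'" for w w'
    using P by (simp add: T_def det2_def field_simps)
  \<comment> \<open>The polarised trace identity: \<open>det2 w (T w') + det2 (T w) w'\<close> is
    the trace of \<open>T\<close> times \<open>det2 w w'\<close>.\<close>
  have trace: "det2 w (T w') = 2 * det2 w w' + det2 w' (T w)" for w w'
    using P by (simp add: T_def det2_def field_simps)
  \<comment> \<open>One vector per polygon vertex. The last one is determined by having determinant
    1 with \<open>y 0\<close>, the closing side after a change of sign, and with \<open>y N\<close>,
    the central diagonal.\<close>
  define y where "y i = (if i \<le> N then x i else if i \<le> 2 * N then T (x (i - N)) else (- 1 / P, 1))"
    for i
  have TN: "T (x 0) = x N" using x P by (simp add: T_def)
  have yT: "y i = T (x (i - N))" if "N \<le> i" "i \<le> 2 * N" for i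
    using that TN by (auto simp: y_def)
  have y_step: "det2 (y i) (y (i + 1)) = 1" if i: "0 \<le> i" "i < 2 * N + 1" for i
  proof -
    consider "i < N" | "N \<le> i" "i < 2 * N" | "i = 2 * N" using i by linarith
    then show ?thesis
    proof cases
      case 1
      then show ?thesis using x(3)[of i] i by (simp add: y_def)
    next
      case 2
      then show ?thesis using x(3)[of "i - N"] by (simp add: yT T algebra_simps)
    next
      case 3
      then show ?thesis using yT[of i] N x P by (simp add: y_def T_def det2_def)
    qed
  qed
  define W where "W = 2 * N + 2"
  \<comment> \<open>Antiperiodic with period the number \<open>W\<close> of polygon vertices. The
    sign gives the closing side determinant +1 and makes both borders of the array equal to
    1.\<close>
  define z where "z i = (if even (i div W) then y (i mod W)
    else (- fst (y (i mod W)), - snd (y (i mod W))))" for i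
  have W: "W > 0" using N by (simp add: W_def)
  have z_y: "z i = y i" if "0 \<le> i" "i \<le> 2 * N + 1" for i
    using that by (simp add: z_def W_def)
  have z_W: "z (i + W) = (- fst (z i), - snd (z i))" for i
  proof -
    have "(i + W) div W = i div W + 1" using W by (intro div_add_self2) simp
    then show ?thesis by (simp add: z_def)
  qed
  have z_y': "z i = (- fst (y (i + W)), - snd (y (i + W)))" if "- W \<le> i" "i < 0" for i
  proof -
    have "y (i + W) = (- fst (z i), - snd (z i))"
      using z_y[of "i + W"] that unfolding z_W by (simp add: W_def)
    then show ?thesis by simp
  qed
  have z_step: "det2 (z i) (z (i + 1)) = 1" for i
  proof -
    define q s where "q = i div W" and "s = i mod W"
    have i: "i = s + W * q" and s: "0 \<le> s" "s < W"
      using W by (simp_all add: q_def s_def)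
    have zi: "z i = (if even q then y s else (- fst (y s), - snd (y s)))"
      by (simp add: z_def q_def s_def)
    show ?thesis
    proof (cases "s = W - 1")
      case True
      then have "i + 1 = (q + 1) * W" using i by (simp add: algebra_simps)
      then have "(i + 1) div W = q + 1" "(i + 1) mod W = 0" using W by simp_all
      moreover have "y s = (- 1 / P, 1)" "y 0 = (1, 0)"
        using True N x by (auto simp: y_def W_def)
      ultimately show ?thesis
        using P by (simp add: zi det2_def) (simp add: z_def)
    next
      case False
      then have "s + 1 < W" using s by simp
      then have "(i + 1) div W = q" "(i + 1) mod W = s + 1"
        using s i int_div_pos_eq[of "i + 1" W q "s + 1"] int_mod_pos_eq[of "i + 1" W q "s + 1"]
        by simp_all
      then have "z (i + 1) = (if even q then y (s + 1) else (- fst (y (s + 1)), - snd (y (s + 1))))"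
        by (simp add: z_def)
      moreover have "det2 (y s) (y (s + 1)) = 1"
        using y_step[of s] s False by (simp add: W_def)
      ultimately show ?thesis using zi by (simp add: det2_def)
    qed
  qed
  define c where "c i j = det2 (z i) (z j)" for i j
  show ?thesis
  proof
    fix i j
    show "c i j * c (i + 1) (j + 1) = 1 + c (i + 1) j * c i (j + 1)"
      unfolding c_def by (subst det2_pluecker) (simp add: z_step)
    show "c i (i + 1) = 1" by (simp add: c_def z_step)
    have "z (i + 2 * N + 1) = (- fst (z (i - 1)), - snd (z (i - 1)))"
      using z_W[of "i - 1"] by (simp add: W_def algebra_simps)
    then show "c i (i + 2 * int n + 1) = 1"
      using z_step[of "i - 1"] by (simp add: c_def det2_def N_def mult.commute)
  next
    have "z (- 1) = (1 / P, - 1)" "z N = (0, P)"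
      using N x by (simp_all add: z_y z_y' W_def) (simp_all add: y_def)
    then show "c (- 1) (int n) = 1" using P by (simp add: c_def det2_def flip: N_def)
  next
    have \<gamma>: "t < n \<Longrightarrow> 0 \<le> \<gamma> t \<and> \<gamma> t \<le> int t" for t
    proof (induction t)
      case (Suc t)
      then show ?case using assms(3)[of t] by fastforce
    qed (simp add: assms)
    {
      fix t assume t: "t < n"
      then have tN: "int t < N" by (simp add: N_def)
      show "c (\<gamma> t) (\<gamma> t + int n - int t) = v t"
        using x(4)[OF t] \<gamma>[OF t] tN N by (simp add: c_def z_y y_def flip: N_def)
      \<comment> \<open>The diagonals of the left half start at negative indices. Moving this end by
        \<open>W\<close> costs a sign, which swapping the two arguments of \<open>det2\<close>
        absorbs; what remains is the image under \<open>T\<close> of a diagonal of the right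
        half.\<close>
      have "z (\<gamma> t - 2 - int t) =
          (- fst (y (\<gamma> t + 2 * N - int t)), - snd (y (\<gamma> t + 2 * N - int t)))"
        using z_y'[of "\<gamma> t - 2 - int t"] \<gamma>[OF t] tN N by (simp add: W_def algebra_simps)
      moreover have "y (\<gamma> t + 2 * N - int t) = T (x (\<gamma> t + N - int t))"
        using yT[of "\<gamma> t + 2 * N - int t"] \<gamma>[OF t] tN by (simp add: algebra_simps)
      moreover have "z (\<gamma> t + N) = T (x (\<gamma> t))"
        using \<gamma>[OF t] tN N yT[of "\<gamma> t + N"] by (simp add: z_y)
      ultimately have "c (\<gamma> t - 2 - int t) (\<gamma> t + int n) =
          det2 (T (x (\<gamma> t))) (T (x (\<gamma> t + N - int t)))"
        by (simp add: c_def det2_def flip: N_def)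
      then show "c (\<gamma> t - 2 - int t) (\<gamma> t + int n) = v t"
        using x(4)[OF t] by (simp add: T)
    }
  next
    \<comment> \<open>Both \<open>i\<close> and \<open>i + 1\<close> must lie between 0 and
      \<open>n\<close> for \<open>T\<close> to carry their vectors to those at \<open>i + n\<close>
      and \<open>i + n + 1\<close>; hence the range.\<close>
    fix i :: int assume i: "0 \<le> i" "i < int n"
    then have iN: "i < N" by (simp add: N_def)
    have "z (i + N + 1) = T (x (i + 1))" "z (i + N) = T (x i)" "z i = x i" "z (i + 1) = x (i + 1)"
      using i iN N yT[of "i + N + 1"] yT[of "i + N"] by (simp_all add: z_y) (simp_all add: y_def)
    then show "c i (i + int n + 1) = 2 + c (i + 1) (i + int n)"
      using trace[of "x i" "x (i + 1)"] x(3)[of i] i iN by (simp add: c_def flip: N_def)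
  qed
qed


section \<open>Coordinates on translation quivers of type A\<close>

text \<open>Replaces the bijection onto unordered edges by a condition on ordered pairs. Loops are
  excluded since at a loop the second condition would contradict itself.\<close>

lemma is_orientation_iff:
  assumes "\<And>e. e \<in> E \<Longrightarrow> \<exists>i j. e = {i, j} \<and> i \<noteq> j"
  shows "is_orientation A E \<longleftrightarrow>
    (\<forall>i j. (i, j) \<in> A \<longrightarrow> {i, j} \<in> E) \<and> (\<forall>i j. {i, j} \<in> E \<longrightarrow> ((i, j) \<in> A \<longleftrightarrow> (j, i) \<notin> A))"
    (is "?L \<longleftrightarrow> ?R")
proof
  assume ?L
  then have inj: "inj_on (\<lambda>(i, j). {i, j}) A" and im: "(\<lambda>(i, j). {i, j}) ` A = E"
    by (auto simp: is_orientation_def bij_betw_def)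
  have "(i, j) \<in> A \<longleftrightarrow> (j, i) \<notin> A" if e: "{i, j} \<in> E" for i j
  proof -
    have "i \<noteq> j" using assms[OF e] by (auto simp: doubleton_eq_iff)
    have "{i, j} \<in> (\<lambda>(i, j). {i, j}) ` A" using e im by simp
    then obtain i' j' where "(i', j') \<in> A" "{i, j} = {i', j'}" by auto
    then have "(i, j) \<in> A \<or> (j, i) \<in> A" by (auto simp: doubleton_eq_iff)
    moreover have "\<not> ((i, j) \<in> A \<and> (j, i) \<in> A)"
      using inj_onD[OF inj, of "(i, j)" "(j, i)"] \<open>i \<noteq> j\<close> by (auto simp: insert_commute)
    ultimately show ?thesis by blast
  qed
  moreover have "{i, j} \<in> E" if "(i, j) \<in> A" for i j
    using imageI[OF that, of "\<lambda>(i, j). {i, j}"] im by simp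
  ultimately show ?R by simp
next
  assume R: ?R
  have "inj_on (\<lambda>(i, j). {i, j}) A"
    using R by (auto simp: inj_on_def doubleton_eq_iff)
  moreover have "e \<in> (\<lambda>(i, j). {i, j}) ` A" if e: "e \<in> E" for e
  proof -
    obtain i j where "e = {i, j}" using assms[OF e] by blast
    then show ?thesis using R e by (metis (mono_tags, lifting) case_prod_conv image_eqI insert_commute)
  qed
  ultimately show ?L using R by (auto simp: is_orientation_def bij_betw_def)
qed

lemma type_A_iff:
  "type_A N \<Theta> \<longleftrightarrow> pverts \<Theta> = {1..N} \<and>
    (\<forall>i j. (i, j) \<in> parcs \<Theta> \<longrightarrow> (\<exists>q. 1 \<le> q \<and> q < N \<and> (i = q \<and> j = Suc q \<or> i = Suc q \<and> j = q))) \<and>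
    (\<forall>q. 1 \<le> q \<and> q < N \<longrightarrow> ((Suc q, q) \<in> parcs \<Theta> \<longleftrightarrow> (q, Suc q) \<notin> parcs \<Theta>))"
proof -
  let ?E = "{{i, i + 1} | i. 1 \<le> i \<and> i < N}"
  have E: "{i, j} \<in> ?E \<longleftrightarrow> (\<exists>q. 1 \<le> q \<and> q < N \<and> (i = q \<and> j = Suc q \<or> i = Suc q \<and> j = q))" for i j
    by (auto simp: doubleton_eq_iff)
  have "\<exists>i j. e = {i, j} \<and> i \<noteq> j" if "e \<in> ?E" for e using that by fastforce
  from is_orientation_iff[of ?E "parcs \<Theta>", OF this]
  have "is_orientation (parcs \<Theta>) ?E \<longleftrightarrow>
    (\<forall>i j. (i, j) \<in> parcs \<Theta> \<longrightarrow> {i, j} \<in> ?E) \<and>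
    (\<forall>i j. {i, j} \<in> ?E \<longrightarrow> ((i, j) \<in> parcs \<Theta> \<longleftrightarrow> (j, i) \<notin> parcs \<Theta>))" .
  moreover have "(\<forall>i j. {i, j} \<in> ?E \<longrightarrow> ((i, j) \<in> parcs \<Theta> \<longleftrightarrow> (j, i) \<notin> parcs \<Theta>)) \<longleftrightarrow>
    (\<forall>q. 1 \<le> q \<and> q < N \<longrightarrow> ((Suc q, q) \<in> parcs \<Theta> \<longleftrightarrow> (q, Suc q) \<notin> parcs \<Theta>))"
    unfolding E by auto
  ultimately show ?thesis
    unfolding type_A_def E by (simp only:)
qed

locale type_A_quiver =
  fixes N :: nat and \<Theta> :: "nat quiver"
  assumes type_A: "type_A N \<Theta>"
begin

lemma verts: "pverts \<Theta> = {1..N}"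
  using type_A by (simp add: type_A_iff)

lemma arcD:
  "(i, j) \<in> parcs \<Theta> \<Longrightarrow> \<exists>q. 1 \<le> q \<and> q < N \<and> (i = q \<and> j = Suc q \<or> i = Suc q \<and> j = q)"
  using type_A by (simp add: type_A_iff)

lemma arc_flip: "1 \<le> q \<Longrightarrow> q < N \<Longrightarrow> (Suc q, q) \<in> parcs \<Theta> \<longleftrightarrow> (q, Suc q) \<notin> parcs \<Theta>"
  using type_A by (simp add: type_A_iff)

text \<open>Counts the arrows pointing right to the left of row \<open>r\<close>. Adding it to
  \<open>k\<close> straightens the slices, so that the diagonal directions no longer depend on the
  orientation of the quiver.\<close>

definition height :: "nat \<Rightarrow> int" where
  "height r = int (card {q. q < r \<and> (q, Suc q) \<in> parcs \<Theta>})"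

lemma height_Suc: "height (Suc r) = height r + (if (r, Suc r) \<in> parcs \<Theta> then 1 else 0)"
proof -
  have "{q. q < Suc r \<and> (q, Suc q) \<in> parcs \<Theta>} = {q. q < r \<and> (q, Suc q) \<in> parcs \<Theta>} \<union>
      (if (r, Suc r) \<in> parcs \<Theta> then {r} else {})"
    by (auto simp: less_Suc_eq)
  then show ?thesis by (simp add: height_def)
qed

lemma height_add_le: "height r \<le> height (r + t) \<and> height (r + t) \<le> height r + int t"
  by (induction t) (auto simp: height_Suc)

text \<open>An arrow to the right raises the height and the index by 1, an arrow to the left keeps
  the height and lowers the index by 1; the rank grows by 1 in both cases. Acyclicity follows, later
  also for \<open>Q\<close>.\<close>

lemma arc_rank_less: "(i, j) \<in> parcs \<Theta> \<Longrightarrow> 2 * height i - int i < 2 * height j - int j"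
  using arcD[of i j] arc_flip by (fastforce simp: height_Suc)

lemma acyclic: "acyclic (parcs \<Theta>)"
proof (rule acyclicI, rule allI, rule notI)
  fix x assume "(x, x) \<in> (parcs \<Theta>)\<^sup>+"
  moreover have "2 * height x - int x < 2 * height y - int y" if "(x, y) \<in> (parcs \<Theta>)\<^sup>+" for y
    using that by (induction rule: trancl_induct) (auto dest: arc_rank_less)
  ultimately show False by blast
qed

sublocale acyclic_quiver \<Theta>
proof
  show sub: "parcs \<Theta> \<subseteq> pverts \<Theta> \<times> pverts \<Theta>" using arcD by (fastforce simp: verts)
  show "finite (parcs \<Theta>)" by (rule finite_subset[OF sub]) (simp add: verts)
qed (rule acyclic)

text \<open>
  The sum \<open>k + height r\<close> is constant along south-east arrows, \<open>k + height r - r\<close> along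
  north-east arrows.
\<close>

lemma translation_arc_iff:
  "((k, r), (l, s)) \<in> parcs (translation_quiver \<Theta>) \<longleftrightarrow>
    r \<in> {1..N} \<and> s \<in> {1..N} \<and>
    (s = Suc r \<and> l + height s = k + height r + 1 \<or> r = Suc s \<and> l + height s = k + height r)"
proof -
  have "((k, r), (l, s)) \<in> parcs (translation_quiver \<Theta>) \<longleftrightarrow>
      l = k \<and> (r, s) \<in> parcs \<Theta> \<or> l = k + 1 \<and> (s, r) \<in> parcs \<Theta>"
    by (auto simp: translation_quiver_def)
  also have "\<dots> \<longleftrightarrow> r \<in> {1..N} \<and> s \<in> {1..N} \<and>
    (s = Suc r \<and> l + height s = k + height r + 1 \<or> r = Suc s \<and> l + height s = k + height r)"
    (is "?L \<longleftrightarrow> ?R")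
  proof (cases "s = Suc r \<or> r = Suc s")
    case True
    then show ?thesis
    proof
      assume s: "s = Suc r"
      then show ?thesis using arc_flip[of r] arcD[of r s] arcD[of s r]
        by (auto simp: height_Suc)
    next
      assume r: "r = Suc s"
      then show ?thesis using arc_flip[of s] arcD[of r s] arcD[of s r]
        by (auto simp: height_Suc)
    qed
  next
    case False
    then show ?thesis using arcD[of r s] arcD[of s r] by auto
  qed
  finally show ?thesis .
qed

lemma neighbour_prod:
  fixes f :: "nat \<Rightarrow> 'f::field"
  assumes "S \<subseteq> {Suc r, r - 1}" "r \<ge> 1"
  shows "prod f S = (if Suc r \<in> S then f (Suc r) else 1) * (if r - 1 \<in> S then f (r - 1) else 1)"
proof -
  have "S = (if Suc r \<in> S then {Suc r} else {}) \<union> (if r - 1 \<in> S then {r - 1} else {})"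
    using assms by (auto split: if_splits)
  then have "prod f S =
      prod f ((if Suc r \<in> S then {Suc r} else {}) \<union> (if r - 1 \<in> S then {r - 1} else {}))"
    by simp
  also have "\<dots> = prod f (if Suc r \<in> S then {Suc r} else {}) * prod f (if r - 1 \<in> S then {r - 1} else {})"
    by (rule prod.union_disjoint) (use assms in auto)
  finally show ?thesis by (auto split: if_splits)
qed

text \<open>Row \<open>r\<close> holds the entries with index difference \<open>N + 2 - r\<close>.
  The differences 1 and \<open>N + 2\<close> act as rows \<open>N + 1\<close> and 0 filled with
  ones, replacing the missing neighbours of the extreme rows. The parameter \<open>\<kappa>\<close>
  chooses the origin.\<close>

lemma frieze_of_array:
  fixes c :: "int \<Rightarrow> int \<Rightarrow> 'f::field"
  assumes diamond: "\<And>i j. c i j * c (i + 1) (j + 1) = 1 + c (i + 1) j * c i (j + 1)"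
    and bottom: "\<And>i. c i (i + int N + 2) = 1" and top: "\<And>i. c i (i + 1) = 1"
    and init: "\<And>r. r \<in> {1..N} \<Longrightarrow>
      init r = c (height r - \<kappa>) (height r - \<kappa> + int N + 2 - int r)"
  shows "is_frieze \<Theta> init (restrict
    (\<lambda>(k, r). c (k + height r - \<kappa>) (k + height r - \<kappa> + int N + 2 - int r)) (UNIV \<times> pverts \<Theta>))"
    (is "is_frieze \<Theta> init ?a")
proof -
  define b where "b k r = c (k + height r - \<kappa>) (k + height r - \<kappa> + int N + 2 - int r)" for k r
  have a: "?a (k, r) = b k r" if "r \<in> {1..N}" for k r
    using that by (simp add: b_def verts)
  have "?a (k, r) * ?a (k + 1, r) = 1 + (\<Prod>j\<in>parcs \<Theta> `` {r}. ?a (k, j)) *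
      (\<Prod>j\<in>(parcs \<Theta>)\<inverse> `` {r}. ?a (k + 1, j))" if r: "r \<in> {1..N}" for k r
  proof -
    define i j where "i = k + height r - \<kappa>" and "j = k + height r - \<kappa> + int N + 2 - int r"
    have nb: "parcs \<Theta> `` {r} \<subseteq> {Suc r, r - 1}" "(parcs \<Theta>)\<inverse> `` {r} \<subseteq> {Suc r, r - 1}"
      using arcD by fastforce+
    \<comment> \<open>The edge to row \<open>Suc r\<close> contributes in slice \<open>k\<close> or
      in slice \<open>k + 1\<close>, depending on its orientation; the jump of \<open>height\<close>
      makes both the same array entry. The edge below behaves alike.\<close>
    have up: "(if (r, Suc r) \<in> parcs \<Theta> then b k (Suc r) else 1) *
        (if (Suc r, r) \<in> parcs \<Theta> then b (k + 1) (Suc r) else 1) = c (i + 1) j"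
    proof (cases "r = N")
      case True
      then have "(r, Suc r) \<notin> parcs \<Theta>" "(Suc r, r) \<notin> parcs \<Theta>" "j = i + 1 + 1"
        using arcD[of r "Suc r"] arcD[of "Suc r" r] by (auto simp: i_def j_def)
      then show ?thesis using top[of "i + 1"] by simp
    next
      case False
      then show ?thesis using r arc_flip[of r]
        by (auto simp: b_def i_def j_def height_Suc algebra_simps)
    qed
    have down: "(if (r, r - 1) \<in> parcs \<Theta> then b k (r - 1) else 1) *
        (if (r - 1, r) \<in> parcs \<Theta> then b (k + 1) (r - 1) else 1) = c i (j + 1)"
    proof (cases "r = 1")
      case True
      then have "(r, r - 1) \<notin> parcs \<Theta>" "(r - 1, r) \<notin> parcs \<Theta>" "j + 1 = i + int N + 2"
        using arcD[of r "r - 1"] arcD[of "r - 1" r] by (auto simp: i_def j_def)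
      moreover from this have "c i (j + 1) = 1" using bottom[of i] by (simp only:)
      ultimately show ?thesis by simp
    next
      case False
      then obtain q where "r = Suc q" "1 \<le> q" "q < N" using r by (cases r) auto
      then show ?thesis using arc_flip[of q]
        by (auto simp: b_def i_def j_def height_Suc algebra_simps)
    qed
    have "(\<Prod>j\<in>parcs \<Theta> `` {r}. ?a (k, j)) * (\<Prod>j\<in>(parcs \<Theta>)\<inverse> `` {r}. ?a (k + 1, j)) =
        (\<Prod>j\<in>parcs \<Theta> `` {r}. b k j) * (\<Prod>j\<in>(parcs \<Theta>)\<inverse> `` {r}. b (k + 1) j)"
      by (intro arg_cong2[of _ _ _ _ "(*)"] prod.cong refl a) (use arcs_subset verts in auto)
    also have "\<dots> = c (i + 1) j * c i (j + 1)"
      using r unfolding up[symmetric] down[symmetric]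
      by (simp only: neighbour_prod[OF nb(1)] neighbour_prod[OF nb(2)] atLeastAtMost_iff
          Image_singleton_iff converse_iff ac_simps)
    finally have "(\<Prod>j\<in>parcs \<Theta> `` {r}. ?a (k, j)) * (\<Prod>j\<in>(parcs \<Theta>)\<inverse> `` {r}. ?a (k + 1, j)) =
        c (i + 1) j * c i (j + 1)" .
    moreover have "b k r = c i j" "b (k + 1) r = c (i + 1) (j + 1)"
      by (simp_all add: b_def i_def j_def algebra_simps)
    ultimately show ?thesis by (simp only: a[OF r] diamond)
  qed
  then show ?thesis
    using init by (auto simp: is_frieze_iff verts)
qed

text \<open>In array coordinates with origin \<open>\<kappa>\<close>, the first index is 0 on this
  diagonal and the second index is \<open>N + 2\<close> on
  \<open>ascending \<kappa>\<close>.\<close>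

definition descending :: "int \<Rightarrow> (int \<times> nat) list" where
  "descending \<kappa> = map (\<lambda>r. (\<kappa> - height r, r)) (rev [1..<Suc N])"

definition ascending :: "int \<Rightarrow> (int \<times> nat) list" where
  "ascending \<kappa> = map (\<lambda>r. (\<kappa> + int r - height r, r)) [1..<Suc N]"

lemma fundamental_diagonals:
  assumes "N \<ge> 1"
  shows "fundamental_diagonals N \<Theta> (\<kappa> - height N) (descending \<kappa>) (ascending \<kappa>)"
proof -
  have "successively (\<lambda>v w. (v, w) \<in> south_east \<Theta>) (descending \<kappa>)"
    unfolding descending_def successively_map successively_rev
    by (auto simp: successively_conv_nth south_east_def translation_arc_iff simp del: upt_Suc)
  moreover have "successively (\<lambda>v w. (v, w) \<in> north_east \<Theta>) (ascending \<kappa>)"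
    unfolding ascending_def successively_map
    by (auto simp: successively_conv_nth north_east_def translation_arc_iff simp del: upt_Suc)
  moreover have "length (descending \<kappa>) = N" "length (ascending \<kappa>) = N"
    by (simp_all add: descending_def ascending_def)
  moreover have "hd (descending \<kappa>) = (\<kappa> - height N, N)" "last (ascending \<kappa>) = (\<kappa> + int N - height N, N)"
    "snd (hd (ascending \<kappa>)) = 1"
    using assms by (simp_all add: descending_def ascending_def hd_map hd_rev last_map del: upt_Suc)
  ultimately show ?thesis
    using type_A by (simp add: fundamental_diagonals_def descending_diagonal_def ascending_diagonal_def)
qed

lemma mem_descending: "(k, r) \<in> set (descending \<kappa>) \<longleftrightarrow> r \<in> {1..N} \<and> k = \<kappa> - height r"
  by (auto simp: descending_def image_iff simp del: upt_Suc)

lemma mem_ascending: "(k, r) \<in> set (ascending \<kappa>) \<longleftrightarrow> r \<in> {1..N} \<and> k = \<kappa> + int r - height r"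
  by (auto simp: ascending_def image_iff simp del: upt_Suc)

lemma region_between_diagonals:
  "region_between (descending \<kappa>) (ascending \<kappa>) =
    {(k, r). r \<in> {1..N} \<and> \<kappa> - height r \<le> k \<and> k \<le> \<kappa> + int r - height r}"
  by (auto simp: region_between_def mem_descending mem_ascending)

end


section \<open>The seed with symmetric fork\<close>

locale symmetric_fork =
  fixes n :: nat and Q :: "nat quiver"
  assumes n: "n \<ge> 4" and type_D: "type_D n Q"
    and fork: "fork_enters_joint Q \<or> fork_leaves_joint Q"
begin

abbreviation \<Lambda> :: "nat quiver" where
  "\<Lambda> \<equiv> Lambda_quiver n Q"

lemma verts_Q: "pverts Q = {1..n}"
  using type_D by (simp add: type_D_def)

lemma orientation_Q:
  "(i, j) \<in> parcs Q \<Longrightarrow> {i, j} = {1, 3} \<or> {i, j} = {2, 3} \<or> (\<exists>q. 3 \<le> q \<and> q < n \<and> {i, j} = {q, Suc q})"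
  "{i, j} = {1, 3} \<or> {i, j} = {2, 3} \<or> (\<exists>q. 3 \<le> q \<and> q < n \<and> {i, j} = {q, Suc q}) \<Longrightarrow>
    (i, j) \<in> parcs Q \<longleftrightarrow> (j, i) \<notin> parcs Q"
proof -
  let ?E = "{{1, 3}, {2, 3}} \<union> {{i, i + 1} | i. 3 \<le> i \<and> i < n}"
  have E: "e \<in> ?E \<longleftrightarrow> e = {1, 3} \<or> e = {2, 3} \<or> (\<exists>q. 3 \<le> q \<and> q < n \<and> e = {q, Suc q})" for e
    by auto
  have distinct: "\<exists>i j. e = {i, j} \<and> i \<noteq> j" if "e \<in> ?E" for e
  proof -
    have "(1::nat) \<noteq> 3" "(2::nat) \<noteq> 3" "\<And>q. q \<noteq> Suc q" by simp_all
    then show ?thesis using that unfolding E by blast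
  qed
  have "is_orientation (parcs Q) ?E" using type_D by (simp add: type_D_def)
  then have orient: "(\<forall>i j. (i, j) \<in> parcs Q \<longrightarrow> {i, j} \<in> ?E) \<and>
      (\<forall>i j. {i, j} \<in> ?E \<longrightarrow> ((i, j) \<in> parcs Q \<longleftrightarrow> (j, i) \<notin> parcs Q))"
    using is_orientation_iff[of ?E "parcs Q", OF distinct] by (simp only:)
  show "{i, j} = {1, 3} \<or> {i, j} = {2, 3} \<or> (\<exists>q. 3 \<le> q \<and> q < n \<and> {i, j} = {q, Suc q})"
    if "(i, j) \<in> parcs Q"
    using orient[THEN conjunct1, rule_format, OF that] unfolding E .
  show "(i, j) \<in> parcs Q \<longleftrightarrow> (j, i) \<notin> parcs Q"
    if "{i, j} = {1, 3} \<or> {i, j} = {2, 3} \<or> (\<exists>q. 3 \<le> q \<and> q < n \<and> {i, j} = {q, Suc q})"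
    by (rule orient[THEN conjunct2, rule_format]) (unfold E, rule that)
qed

lemma arc_Q_cases:
  assumes "(i, j) \<in> parcs Q"
  obtains "i \<in> {1, 2}" "j = 3" | "i = 3" "j \<in> {1, 2}"
    | "3 \<le> i" "i < n" "j = Suc i" | "3 \<le> j" "j < n" "i = Suc j"
  using orientation_Q(1)[OF assms] by (auto simp: doubleton_eq_iff)

lemma flip_Q: "3 \<le> q \<Longrightarrow> q < n \<Longrightarrow> (Suc q, q) \<in> parcs Q \<longleftrightarrow> (q, Suc q) \<notin> parcs Q"
  using orientation_Q(2)[of "Suc q" q] by (auto simp: doubleton_eq_iff)

text \<open>Here the hypothesis on the fork enters: the edge 1-3 determines the orientation of both
  fork edges.\<close>

lemma fork_Q: "i \<in> {1, 2} \<Longrightarrow> (i, 3) \<in> parcs Q \<longleftrightarrow> (1, 3) \<in> parcs Q"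
  "i \<in> {1, 2} \<Longrightarrow> (3, i) \<in> parcs Q \<longleftrightarrow> (1, 3) \<notin> parcs Q"
proof -
  have "(1, 3) \<in> parcs Q \<longleftrightarrow> (3, 1) \<notin> parcs Q" "(2, 3) \<in> parcs Q \<longleftrightarrow> (3, 2) \<notin> parcs Q"
    using orientation_Q(2)[of 1 3] orientation_Q(2)[of 2 3] by auto
  then show "i \<in> {1, 2} \<Longrightarrow> (i, 3) \<in> parcs Q \<longleftrightarrow> (1, 3) \<in> parcs Q"
    "i \<in> {1, 2} \<Longrightarrow> (3, i) \<in> parcs Q \<longleftrightarrow> (1, 3) \<notin> parcs Q"
    using fork by (auto simp: fork_enters_joint_def fork_leaves_joint_def)
qed

section \<open>Arrows of the symmetric seed\<close>

definition label :: "nat \<Rightarrow> nat" where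
  "label t = (if t = 1 then 1 else Suc t)"

text \<open>\<open>label t\<close> sits at distance \<open>t\<close> from the centre
  \<open>n\<close> on both sides, and \<open>rising t\<close> says that the edge between the
  distances \<open>t\<close> and \<open>t + 1\<close> points away from the centre. One predicate for
  both sides expresses the mirror symmetry.\<close>

definition rising :: "nat \<Rightarrow> bool" where
  "rising t \<longleftrightarrow> (label t, label (Suc t)) \<in> parcs Q"

lemma label_pos: "1 \<le> t \<Longrightarrow> right_pos n (label t) = n + t" "1 \<le> t \<Longrightarrow> left_pos n (label t) = n - t"
  by (auto simp: label_def right_pos_def left_pos_def)

lemma arcs_without_2:
  "parcs (full_subquiver Q (- {2})) =
    (\<lambda>t. if rising t then (label t, label (Suc t)) else (label (Suc t), label t)) ` {1..<n - 1}"
    (is "_ = ?arc ` _")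
proof -
  have arc: "?arc t \<in> parcs Q \<and> (if rising t then (label (Suc t), label t) else (label t, label (Suc t))) \<notin> parcs Q"
    if "t \<in> {1..<n - 1}" for t
  proof (cases "t = 1")
    case True
    then show ?thesis using fork_Q[of 1] by (simp add: rising_def label_def numeral_3_eq_3)
  next
    case False
    moreover have "3 \<le> Suc t" "Suc t < n" using that False by auto
    ultimately show ?thesis using flip_Q[of "Suc t"] by (auto simp: rising_def label_def)
  qed
  have "(i, j) \<in> ?arc ` {1..<n - 1}" if "(i, j) \<in> parcs Q" "i \<noteq> 2" "j \<noteq> 2" for i j
  proof -
    have "\<exists>t\<in>{1..<n - 1}. (i, j) = (label t, label (Suc t)) \<or> (i, j) = (label (Suc t), label t)"
      using that(1)
    proof (cases rule: arc_Q_cases)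
      case 1
      then show ?thesis using that n by (intro bexI[of _ 1]) (auto simp: label_def)
    next
      case 2
      then show ?thesis using that n by (intro bexI[of _ 1]) (auto simp: label_def)
    next
      case 3
      then show ?thesis using that n by (intro bexI[of _ "i - 1"]) (auto simp: label_def)
    next
      case 4
      then show ?thesis using that n by (intro bexI[of _ "j - 1"]) (auto simp: label_def)
    qed
    then obtain t where t: "t \<in> {1..<n - 1}"
      "(i, j) = (label t, label (Suc t)) \<or> (i, j) = (label (Suc t), label t)" by blast
    then have "(i, j) = ?arc t" using arc[OF t(1)] that(1) by (auto split: if_splits)
    then show ?thesis using t(1) by (rule image_eqI)
  qed
  then have "parcs (full_subquiver Q (- {2})) \<subseteq> ?arc ` {1..<n - 1}"
    by (auto simp only: full_subquiver_def pair_pre_digraph.simps)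
  moreover have "?arc t \<in> parcs (full_subquiver Q (- {2}))" if t: "t \<in> {1..<n - 1}" for t
  proof -
    have "label t \<noteq> 2" "label (Suc t) \<noteq> 2" using t by (auto simp: label_def)
    then show ?thesis using arc[OF t] by (cases "rising t") (simp_all add: full_subquiver_def)
  qed
  ultimately show ?thesis by blast
qed

lemma arcs_Lambda:
  "parcs \<Lambda> = {(n - 1, n), (n, n + 1)} \<union>
    (\<lambda>t. if rising t then (n + t, n + Suc t) else (n + Suc t, n + t)) ` {1..<n - 1} \<union>
    (\<lambda>t. if rising t then (n - t, n - Suc t) else (n - Suc t, n - t)) ` {1..<n - 1}"
proof -
  let ?arc = "\<lambda>t. if rising t then (label t, label (Suc t)) else (label (Suc t), label t)"
  have "map_prod (right_pos n) (right_pos n) ` ?arc ` {1..<n - 1} =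
      (\<lambda>t. if rising t then (n + t, n + Suc t) else (n + Suc t, n + t)) ` {1..<n - 1}"
    unfolding image_image by (rule image_cong) (auto simp: label_pos)
  moreover have "map_prod (left_pos n) (left_pos n) ` ?arc ` {1..<n - 1} =
      (\<lambda>t. if rising t then (n - t, n - Suc t) else (n - Suc t, n - t)) ` {1..<n - 1}"
    unfolding image_image by (rule image_cong) (auto simp: label_pos)
  ultimately show ?thesis
    unfolding Lambda_quiver_def Let_def image_quiver_def by (simp add: arcs_without_2 Un_ac)
qed

text \<open>The left half is described by sums equal to \<open>n\<close>, which avoids truncated
  subtraction in the case analyses that follow.\<close>

lemma mem_arcs_Lambda:
  "(r, s) \<in> parcs \<Lambda> \<longleftrightarrow> r + 1 = n \<and> s = n \<or> r = n \<and> s = Suc n \<or>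
    (\<exists>t. 1 \<le> t \<and> t < n - 1 \<and>
      (if rising t then r = n + t \<and> s = n + Suc t \<or> r + t = n \<and> s + Suc t = n
       else r = n + Suc t \<and> s = n + t \<or> r + Suc t = n \<and> s + t = n))"
proof -
  have "(r, s) \<in> {(n - 1, n), (n, n + 1)} \<longleftrightarrow> r + 1 = n \<and> s = n \<or> r = n \<and> s = Suc n"
    using n by auto
  moreover have "(r, s) \<in> (\<lambda>t. if rising t then (n + t, n + Suc t) else (n + Suc t, n + t)) ` {1..<n - 1} \<longleftrightarrow>
      (\<exists>t. 1 \<le> t \<and> t < n - 1 \<and> (if rising t then r = n + t \<and> s = n + Suc t else r = n + Suc t \<and> s = n + t))"
    unfolding image_iff Bex_def atLeastLessThan_iff by (intro ex_cong1) (simp add: conj_assoc)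
  moreover have "(r, s) = (if rising t then (n - t, n - Suc t) else (n - Suc t, n - t)) \<longleftrightarrow>
      (if rising t then r + t = n \<and> s + Suc t = n else r + Suc t = n \<and> s + t = n)"
    if "1 \<le> t" "t < n - 1" for t using that by auto
  then have "(r, s) \<in> (\<lambda>t. if rising t then (n - t, n - Suc t) else (n - Suc t, n - t)) ` {1..<n - 1} \<longleftrightarrow>
      (\<exists>t. 1 \<le> t \<and> t < n - 1 \<and> (if rising t then r + t = n \<and> s + Suc t = n else r + Suc t = n \<and> s + t = n))"
    unfolding image_iff Bex_def atLeastLessThan_iff by (intro ex_cong1) blast
  moreover have "(\<exists>t. P t \<and> P' t \<and> (if b t then X t \<or> Y t else X' t \<or> Y' t)) \<longleftrightarrow>
      (\<exists>t. P t \<and> P' t \<and> (if b t then X t else X' t)) \<or> (\<exists>t. P t \<and> P' t \<and> (if b t then Y t else Y' t))"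
    for P P' b X Y X' Y' :: "nat \<Rightarrow> bool"
    unfolding ex_disj_distrib[symmetric] by (intro ex_cong1) auto
  ultimately show ?thesis
    unfolding arcs_Lambda Un_iff by (simp only: disj_assoc)
qed

lemma Lambda_arc_middle: "(n - 1, n) \<in> parcs \<Lambda>" "(n, Suc n) \<in> parcs \<Lambda>"
  by (simp_all add: arcs_Lambda)

lemma rising_iff:
  assumes "1 \<le> t" "t < n - 1" "(r, s) \<in> parcs \<Lambda>"
  shows "r = n + t \<and> s = n + Suc t \<or> r + t = n \<and> s + Suc t = n \<Longrightarrow> rising t"
    and "r = n + Suc t \<and> s = n + t \<or> r + Suc t = n \<and> s + t = n \<Longrightarrow> \<not> rising t"
proof -
  assume up: "r = n + t \<and> s = n + Suc t \<or> r + t = n \<and> s + Suc t = n"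
  then obtain t' where t': "1 \<le> t'" "t' < n - 1"
    "if rising t' then r = n + t' \<and> s = n + Suc t' \<or> r + t' = n \<and> s + Suc t' = n
       else r = n + Suc t' \<and> s = n + t' \<or> r + Suc t' = n \<and> s + t' = n"
    using assms unfolding mem_arcs_Lambda by (elim disjE exE conjE) auto
  then have "rising t' \<and> t' = t" using up assms(1,2) by (cases "rising t'"; simp; arith)
  then show "rising t" by blast
next
  assume down: "r = n + Suc t \<and> s = n + t \<or> r + Suc t = n \<and> s + t = n"
  then obtain t' where t': "1 \<le> t'" "t' < n - 1"
    "if rising t' then r = n + t' \<and> s = n + Suc t' \<or> r + t' = n \<and> s + Suc t' = n
       else r = n + Suc t' \<and> s = n + t' \<or> r + Suc t' = n \<and> s + t' = n"
    using assms unfolding mem_arcs_Lambda by (elim disjE exE conjE) auto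
  then have "\<not> rising t' \<and> t' = t" using down assms(1,2) by (cases "rising t'"; simp; arith)
  then show "\<not> rising t" by blast
qed

lemma Lambda_arc_iff:
  assumes "1 \<le> t" "t < n - 1"
  shows "(n + t, n + Suc t) \<in> parcs \<Lambda> \<longleftrightarrow> rising t" "(n + Suc t, n + t) \<in> parcs \<Lambda> \<longleftrightarrow> \<not> rising t"
    "(n - t, n - Suc t) \<in> parcs \<Lambda> \<longleftrightarrow> rising t" "(n - Suc t, n - t) \<in> parcs \<Lambda> \<longleftrightarrow> \<not> rising t"
proof -
  have le: "n - t + t = n" "n - Suc t + Suc t = n" using assms by auto
  have up: "rising t \<Longrightarrow> (r, s) \<in> parcs \<Lambda>"
    if "r = n + t \<and> s = n + Suc t \<or> r + t = n \<and> s + Suc t = n" for r s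
    unfolding mem_arcs_Lambda using assms that by (intro disjI2 exI[of _ t]) simp
  have down: "\<not> rising t \<Longrightarrow> (r, s) \<in> parcs \<Lambda>"
    if "r = n + Suc t \<and> s = n + t \<or> r + Suc t = n \<and> s + t = n" for r s
    unfolding mem_arcs_Lambda using assms that by (intro disjI2 exI[of _ t]) simp
  show "(n + t, n + Suc t) \<in> parcs \<Lambda> \<longleftrightarrow> rising t"
    using up[of "n + t" "n + Suc t"] rising_iff(1)[OF assms, of "n + t" "n + Suc t"] by blast
  show "(n + Suc t, n + t) \<in> parcs \<Lambda> \<longleftrightarrow> \<not> rising t"
    using down[of "n + Suc t" "n + t"] rising_iff(2)[OF assms, of "n + Suc t" "n + t"] by blast
  show "(n - t, n - Suc t) \<in> parcs \<Lambda> \<longleftrightarrow> rising t"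
    using up[of "n - t" "n - Suc t"] rising_iff(1)[OF assms, of "n - t" "n - Suc t"] le by blast
  show "(n - Suc t, n - t) \<in> parcs \<Lambda> \<longleftrightarrow> \<not> rising t"
    using down[of "n - Suc t" "n - t"] rising_iff(2)[OF assms, of "n - Suc t" "n - t"] le by blast
qed

lemma verts_Lambda: "pverts \<Lambda> = {1..2 * n - 1}"
proof -
  have "pverts (full_subquiver Q (- {2})) = label ` {1..n - 1}"
  proof (intro equalityI subsetI)
    fix i assume "i \<in> pverts (full_subquiver Q (- {2}))"
    then have "i = label (if i = 1 then 1 else i - 1)" "(if i = 1 then 1 else i - 1) \<in> {1..n - 1}"
      using n by (auto simp: full_subquiver_def verts_Q label_def)
    then show "i \<in> label ` {1..n - 1}" by (rule image_eqI)
  qed (auto simp: full_subquiver_def verts_Q label_def split: if_splits)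
  moreover have "right_pos n ` label ` {1..n - 1} = (\<lambda>t. n + t) ` {1..n - 1}"
    "left_pos n ` label ` {1..n - 1} = (\<lambda>t. n - t) ` {1..n - 1}"
    unfolding image_image by (rule image_cong; simp add: label_pos)+
  moreover have "(\<lambda>t. n + t) ` {1..n - 1} = {n + 1..2 * n - 1}"
    using n by (simp add: image_add_atLeastAtMost mult_2)
  moreover have "(\<lambda>t. n - t) ` {1..n - 1} = {1..n - 1}"
  proof (intro equalityI subsetI)
    fix r assume "r \<in> {1..n - 1}"
    then have "r = n - (n - r)" "n - r \<in> {1..n - 1}" using n by auto
    then show "r \<in> (\<lambda>t. n - t) ` {1..n - 1}" by (rule image_eqI)
  qed auto
  ultimately show ?thesis
    unfolding Lambda_quiver_def Let_def image_quiver_def using n by auto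
qed

lemma type_A_Lambda: "type_A (2 * n - 1) \<Lambda>"
  unfolding type_A_iff
proof (intro conjI allI impI)
  show "pverts \<Lambda> = {1..2 * n - 1}" by (rule verts_Lambda)
next
  fix i j assume "(i, j) \<in> parcs \<Lambda>"
  then consider "i + 1 = n" "j = n" | "i = n" "j = Suc n"
    | t where "1 \<le> t" "t < n - 1" "i = n + t \<and> j = n + Suc t \<or> i = n + Suc t \<and> j = n + t"
    | t where "1 \<le> t" "t < n - 1" "i + t = n \<and> j + Suc t = n \<or> i + Suc t = n \<and> j + t = n"
    unfolding mem_arcs_Lambda by (metis (full_types))
  then show "\<exists>q. 1 \<le> q \<and> q < 2 * n - 1 \<and> (i = q \<and> j = Suc q \<or> i = Suc q \<and> j = q)"
  proof cases
    case 1
    then show ?thesis using n by (intro exI[of _ "n - 1"]) auto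
  next
    case 2
    then show ?thesis using n by (intro exI[of _ n]) auto
  next
    case 3
    then show ?thesis using n by (intro exI[of _ "n + t"]) auto
  next
    case 4
    then show ?thesis using n by (intro exI[of _ "n - Suc t"]) auto
  qed
next
  fix q assume q: "1 \<le> q \<and> q < 2 * n - 1"
  consider "Suc q = n" | "q = n" | "n < q" | "Suc q < n" by linarith
  then show "(Suc q, q) \<in> parcs \<Lambda> \<longleftrightarrow> (q, Suc q) \<notin> parcs \<Lambda>"
  proof cases
    case 1
    then have "q = n - 1" by simp
    then show ?thesis using 1 Lambda_arc_middle(1) by (auto simp: mem_arcs_Lambda split: if_splits)
  next
    case 2
    then show ?thesis using Lambda_arc_middle(2) by (auto simp: mem_arcs_Lambda split: if_splits)
  next
    case 3
    then have "1 \<le> q - n" "q - n < n - 1" using q by auto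
    from Lambda_arc_iff(1,2)[OF this] show ?thesis using 3 by simp
  next
    case 4
    then have "1 \<le> n - Suc q" "n - Suc q < n - 1" using q by auto
    from Lambda_arc_iff(3,4)[OF this] show ?thesis using 4 by (simp add: Suc_diff_Suc)
  qed
qed

sublocale A: type_A_quiver "2 * n - 1" \<Lambda>
  by unfold_locales (rule type_A_Lambda)

text \<open>The row of \<open>to_Lambda n (merge_fork (k, i))\<close>, given on the vertices of
  \<open>Q\<close> themselves. Both friezes can then be compared on \<open>Q\<close>, with the two
  fork vertices going to the same row.\<close>

definition pos :: "nat \<Rightarrow> nat" where
  "pos i = (if i \<le> 2 then n + 1 else n + i - 1)"

lemma arc_Q_iff:
  assumes "i \<in> {1..n}" "j \<in> {1..n}"
  shows "(i, j) \<in> parcs Q \<longleftrightarrow> (pos i, pos j) \<in> parcs \<Lambda>"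
proof
  assume "(i, j) \<in> parcs Q"
  then show "(pos i, pos j) \<in> parcs \<Lambda>"
  proof (cases rule: arc_Q_cases)
    case 1
    then show ?thesis using \<open>(i, j) \<in> parcs Q\<close> n fork_Q(1)[of i] Lambda_arc_iff(1)[of 1]
      by (auto simp: pos_def rising_def label_def numeral_3_eq_3)
  next
    case 2
    then show ?thesis using \<open>(i, j) \<in> parcs Q\<close> n fork_Q(2)[of j] Lambda_arc_iff(2)[of 1]
      by (auto simp: pos_def rising_def label_def numeral_3_eq_3)
  next
    case 3
    then show ?thesis using \<open>(i, j) \<in> parcs Q\<close> n Lambda_arc_iff(1)[of "i - 1"]
      by (auto simp: pos_def rising_def label_def)
  next
    case 4
    then show ?thesis using \<open>(i, j) \<in> parcs Q\<close> n Lambda_arc_iff(2)[of "j - 1"] flip_Q[of j]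
      by (auto simp: pos_def rising_def label_def)
  qed
next
  assume arc: "(pos i, pos j) \<in> parcs \<Lambda>"
  have gt: "pos i > n" "pos j > n" using assms by (auto simp: pos_def)
  have low: "pos i' = n + t \<longleftrightarrow> (if t = 1 then i' \<in> {1, 2} else i' = Suc t)"
    if "i' \<in> {1..n}" "1 \<le> t" for i' t using that by (auto simp: pos_def)
  have "\<exists>t. 1 \<le> t \<and> t < n - 1 \<and>
      (if rising t then pos i = n + t \<and> pos j = n + Suc t \<or> pos i + t = n \<and> pos j + Suc t = n
       else pos i = n + Suc t \<and> pos j = n + t \<or> pos i + Suc t = n \<and> pos j + t = n)"
    using arc gt unfolding mem_arcs_Lambda by (elim disjE, simp, simp, simp only:)
  then obtain t where t: "1 \<le> t" "t < n - 1"
    "if rising t then pos i = n + t \<and> pos j = n + Suc t \<or> pos i + t = n \<and> pos j + Suc t = n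
     else pos i = n + Suc t \<and> pos j = n + t \<or> pos i + Suc t = n \<and> pos j + t = n"
    by (elim exE conjE)
  have t': "pos i = n + t \<and> pos j = n + Suc t \<and> rising t \<or> pos i = n + Suc t \<and> pos j = n + t \<and> \<not> rising t"
    using t(3) gt by (cases "rising t") simp_all
  show "(i, j) \<in> parcs Q"
  proof (cases "t = 1")
    case True
    then have "i \<in> {1, 2} \<and> j = 3 \<and> rising 1 \<or> i = 3 \<and> j \<in> {1, 2} \<and> \<not> rising 1"
      using t' low[OF assms(1), of 1] low[OF assms(2), of 1] low[OF assms(1), of 2]
        low[OF assms(2), of 2] by (simp add: numeral_3_eq_3 numeral_2_eq_2)
    moreover have "rising 1 \<longleftrightarrow> (1, 3) \<in> parcs Q"
      by (simp add: rising_def label_def numeral_3_eq_3)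
    ultimately show ?thesis using fork_Q[of i] fork_Q[of j] by (elim disjE) simp_all
  next
    case False
    have "Suc t < n" "3 \<le> Suc t" using t(1,2) False by auto
    from flip_Q[OF this(2,1)] show ?thesis
      using t' low[OF assms(1), of t] low[OF assms(2), of t] low[OF assms(1), of "Suc t"]
        low[OF assms(2), of "Suc t"] t(1) False
      by (auto simp: rising_def label_def)
  qed
qed


section \<open>The frieze of the symmetric seed in array coordinates\<close>

definition shift :: "nat \<Rightarrow> int" where
  "shift r = A.height r - A.height (n + 1)"

lemma shift_Suc: "shift (Suc r) = shift r + (if (r, Suc r) \<in> parcs \<Lambda> then 1 else 0)"
  by (simp add: shift_def A.height_Suc)

lemma shift_middle: "shift (n + 1) = 0" "shift n = - 1" "shift (n - 1) = - 2"
proof -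
  show "shift (n + 1) = 0" by (simp add: shift_def)
  then show "shift n = - 1" using shift_Suc[of n] Lambda_arc_middle by simp
  then show "shift (n - 1) = - 2" using shift_Suc[of "n - 1"] Lambda_arc_middle n by simp
qed

text \<open>One step outward changes exactly one of the two shifts, the right one upwards if
  \<open>rising t\<close> and the left one downwards otherwise, so their difference grows by 1
  whatever the orientation. It starts at 2 because of the two central arrows.\<close>

lemma shift_mirror:
  assumes "1 \<le> t" "t \<le> n - 1"
  shows "shift (n - t) = shift (n + t) - 1 - int t"
  using assms
proof (induction t rule: nat_induct_at_least)
  case base
  then show ?case using shift_middle by simp
next
  case (Suc t)
  then have t: "1 \<le> t" "t < n - 1" by simp_all
  then have "Suc (n - Suc t) = n - t" by simp
  then have "shift (n - t) = shift (n - Suc t) + (if rising t then 0 else 1)"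
    using shift_Suc[of "n - Suc t"] Lambda_arc_iff(4)[OF t] by simp
  moreover have "shift (n + Suc t) = shift (n + t) + (if rising t then 1 else 0)"
    using shift_Suc[of "n + t"] Lambda_arc_iff(1)[OF t] by simp
  ultimately show ?case using Suc.IH t by (cases "rising t") simp_all
qed

lemma shift_right_bounds:
  assumes "n < r"
  shows "0 \<le> shift r" "shift r \<le> int r - int n - 1"
  using A.height_add_le[of "n + 1" "r - (n + 1)"] assms by (simp_all add: shift_def)

text \<open>Since \<open>shift\<close> vanishes at \<open>n + 1\<close>, the vertex
  \<open>(0, n + 1)\<close> receives the entry \<open>c 0 n\<close>, the diagonal that separates the
  right half of the polygon.\<close>

lemma frieze_Lambda_array:
  fixes u :: "nat \<Rightarrow> 'f::field"
  assumes "semifield_cone C" "\<And>i. u i \<in> C"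
  obtains c :: "int \<Rightarrow> int \<Rightarrow> 'f" where
    "\<And>i j. c i j * c (i + 1) (j + 1) = 1 + c (i + 1) j * c i (j + 1)"
    "\<And>i. 0 \<le> i \<Longrightarrow> i < int n \<Longrightarrow> c i (i + int n + 1) = 2 + c (i + 1) (i + int n)"
    "\<And>k r. r \<in> {1..2 * n - 1} \<Longrightarrow> frieze_value \<Lambda> (Lambda_value n u) (k, r) =
      c (k + shift r) (k + shift r + 2 * int n + 1 - int r)"
proof -
  interpret semifield_cone C by fact
  define \<gamma> where "\<gamma> t = shift (n + 1 + t)" for t
  \<comment> \<open>The index \<open>t = n - 1\<close> lies one past the last row; it stands for a
    side of the polygon, hence the value 1.\<close>
  define v where "v t = (if t < n - 1 then Lambda_value n u (n + 1 + t) else 1)" for t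
  have Lambda_value_mem: "Lambda_value n u r \<in> C" for r
    using assms(2) by (auto simp: Lambda_value_def one_mem mult_mem)
  have v: "v t \<noteq> 0" for t
    using Lambda_value_mem[of "n + 1 + t"] zero_notin by (auto simp: v_def)
  have \<gamma>: "\<gamma> (Suc t) = \<gamma> t \<or> \<gamma> (Suc t) = \<gamma> t + 1" for t
    using shift_Suc[of "n + 1 + t"] by (auto simp: \<gamma>_def)
  have ends: "n \<ge> 1" "\<gamma> 0 = 0" "v (n - 1) = 1"
    using n shift_middle by (simp_all add: \<gamma>_def v_def)
  obtain c :: "int \<Rightarrow> int \<Rightarrow> 'f" where c:
    "\<And>i j. c i j * c (i + 1) (j + 1) = 1 + c (i + 1) j * c i (j + 1)"
    "\<And>i. c i (i + 1) = 1" "\<And>i. c i (i + 2 * int n + 1) = 1"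
    "\<And>t. t < n \<Longrightarrow> c (\<gamma> t) (\<gamma> t + int n - int t) = v t"
    "c (- 1) (int n) = 1"
    "\<And>t. t < n \<Longrightarrow> c (\<gamma> t - 2 - int t) (\<gamma> t + int n) = v t"
    "\<And>i. 0 \<le> i \<Longrightarrow> i < int n \<Longrightarrow> c i (i + int n + 1) = 2 + c (i + 1) (i + int n)"
    by (rule symmetric_array[of n \<gamma> v, OF ends(1,2) \<gamma> v ends(3)]) (rule that)
  have N: "int (2 * n - 1) = 2 * int n - 1" using n by simp
  have init: "Lambda_value n u r = c (shift r) (shift r + 2 * int n + 1 - int r)"
    if r: "r \<in> {1..2 * n - 1}" for r
  proof -
    \<comment> \<open>Centre, right half and left half of the seed; each case uses its own clause of
      \<open>symmetric_array\<close>, the last after \<open>shift_mirror\<close>.\<close>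
    consider "r = n" | t where "t < n - 1" "r = n + 1 + t" | t where "t < n - 1" "r = n - Suc t"
    proof -
      consider "r = n" | "n < r" | "r < n" by linarith
      then show ?thesis
      proof cases
        case 2
        then show ?thesis using r by (intro that(2)[of "r - (n + 1)"]) auto
      next
        case 3
        then show ?thesis using r by (intro that(3)[of "n - Suc r"]) auto
      qed (rule that(1))
    qed
    then show ?thesis
    proof cases
      case 1
      then show ?thesis using c(5) shift_middle by (simp add: Lambda_value_def)
    next
      case 2
      then have "c (\<gamma> t) (\<gamma> t + int n - int t) = Lambda_value n u r"
        using c(4)[of t] by (simp add: v_def)
      then show ?thesis using 2 by (simp add: \<gamma>_def algebra_simps)
    next
      case 3
      have "Lambda_value n u (n - Suc t) = Lambda_value n u (n + 1 + t)"
        using 3(1) n by (cases "t = 0") (auto simp: Lambda_value_def)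
      then have "c (\<gamma> t - 2 - int t) (\<gamma> t + int n) = Lambda_value n u r"
        using c(6)[of t] 3 by (simp add: v_def)
      moreover have shift: "shift r = \<gamma> t - 2 - int t"
        using shift_mirror[of "Suc t"] 3 by (simp add: \<gamma>_def)
      moreover have "shift r + 2 * int n + 1 - int r = \<gamma> t + int n" using 3 shift by simp
      ultimately show ?thesis by (simp only:)
    qed
  qed
  let ?b = "restrict (\<lambda>(k, r). c (k + A.height r - A.height (n + 1))
    (k + A.height r - A.height (n + 1) + int (2 * n - 1) + 2 - int r)) (UNIV \<times> pverts \<Lambda>)"
  have "is_frieze \<Lambda> (Lambda_value n u) ?b"
  proof (rule A.frieze_of_array)
    have "i + int (2 * n - 1) + 2 = i + 2 * int n + 1" for i using N by simp
    then show "c i (i + int (2 * n - 1) + 2) = 1" for i using c(3)[of i] by (simp only:)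
    have "shift r + int (2 * n - 1) + 2 - int r = shift r + 2 * int n + 1 - int r" for r
      using N by simp
    note init' = init[folded this, unfolded shift_def]
    show "Lambda_value n u r = c (A.height r - A.height (n + 1))
        (A.height r - A.height (n + 1) + int (2 * n - 1) + 2 - int r)" if "r \<in> {1..2 * n - 1}" for r
      by (rule init'[OF that])
  qed (use c in simp_all)
  moreover note positive =
    A.frieze_value_positive[OF assms(1), of "Lambda_value n u", OF Lambda_value_mem]
  moreover have "frieze_value \<Lambda> (Lambda_value n u) (k, r) \<noteq> 0" if "r \<in> pverts \<Lambda>" for k r
    using positive(2)[OF that, of k] zero_notin by auto
  ultimately have b: "?b = frieze_value \<Lambda> (Lambda_value n u)"
    by (intro A.frieze_unique)
  have "frieze_value \<Lambda> (Lambda_value n u) (k, r) =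
      c (k + shift r) (k + shift r + 2 * int n + 1 - int r)" if "r \<in> {1..2 * n - 1}" for k r
  proof -
    have "frieze_value \<Lambda> (Lambda_value n u) (k, r) = ?b (k, r)" by (simp only: b)
    also have "\<dots> = c (k + A.height r - A.height (n + 1))
        (k + A.height r - A.height (n + 1) + int (2 * n - 1) + 2 - int r)"
      using that verts_Lambda by simp
    also have "\<dots> = c (k + shift r) (k + shift r + 2 * int n + 1 - int r)"
      unfolding N by (simp add: shift_def algebra_simps)
    finally show ?thesis .
  qed
  then show ?thesis using that c(1,7) by blast
qed


section \<open>Comparison of the type D frieze with the right half of the type A frieze\<close>

lemma pos_in: "i \<in> {1..n} \<Longrightarrow> pos i \<in> {n + 1..2 * n - 1}"
  using n by (auto simp: pos_def)

lemma pos_eq_iff: "3 \<le> i \<Longrightarrow> pos i = pos j \<longleftrightarrow> i = j"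
  using n by (auto simp: pos_def)

lemma pos_surj:
  assumes "r \<in> {n + 1..2 * n - 1}"
  obtains i where "i \<in> {1..n}" "i \<noteq> 2" "r = pos i"
proof (cases "r = n + 1")
  case True
  then show ?thesis using n by (intro that[of 1]) (auto simp: pos_def)
next
  case False
  then show ?thesis using assms by (intro that[of "r + 1 - n"]) (auto simp: pos_def)
qed

sublocale D: acyclic_quiver Q
proof
  show sub: "parcs Q \<subseteq> pverts Q \<times> pverts Q"
  proof
    fix e assume "e \<in> parcs Q"
    then obtain i j where e: "e = (i, j)" "(i, j) \<in> parcs Q" by (cases e) auto
    from e(2) show "e \<in> pverts Q \<times> pverts Q" unfolding e(1)
      by (cases rule: arc_Q_cases) (use n in \<open>auto simp: verts_Q\<close>)
  qed
  show "finite (parcs Q)" by (rule finite_subset[OF sub]) (simp add: verts_Q)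
  have rank: "2 * A.height (pos i) - int (pos i) < 2 * A.height (pos j) - int (pos j)"
    if "(i, j) \<in> parcs Q" for i j
    using that arc_Q_iff[of i j] sub by (intro A.arc_rank_less) (auto simp: verts_Q)
  show "acyclic (parcs Q)"
  proof (rule acyclicI, rule allI, rule notI)
    fix i assume "(i, i) \<in> (parcs Q)\<^sup>+"
    moreover have "2 * A.height (pos i) - int (pos i) < 2 * A.height (pos j) - int (pos j)"
      if "(i, j) \<in> (parcs Q)\<^sup>+" for j
      using that by (induction rule: trancl_induct) (auto dest: rank)
    ultimately show False by blast
  qed
qed

text \<open>If both fork vertices are neighbours, they contribute precisely the merged value, and
  otherwise nothing; relations away from the fork therefore survive the merging.\<close>

lemma prod_merged_fork:
  fixes a b :: "nat \<Rightarrow> 'f::field"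
  assumes "S \<subseteq> {1..n}" "1 \<in> S \<longleftrightarrow> 2 \<in> S"
    and "\<And>j. j \<in> S \<Longrightarrow> (if j \<le> 2 then a 1 * a 2 else a j) = b (pos j)"
  shows "prod a S = prod b (pos ` S)"
proof -
  define S' where "S' = S \<inter> {3..n}"
  have fin: "finite S'" by (simp add: S'_def)
  have "inj_on pos S'" by (auto simp: inj_on_def S'_def pos_eq_iff)
  then have "prod b (pos ` S') = (\<Prod>j\<in>S'. b (pos j))" by (simp add: prod.reindex)
  also have "\<dots> = prod a S'"
    by (rule prod.cong) (use assms(3) in \<open>force simp: S'_def\<close>)+
  finally have S': "prod b (pos ` S') = prod a S'" .
  show ?thesis
  proof (cases "1 \<in> S")
    case True
    then have S: "S = insert 1 (insert 2 S')" using assms(1,2) by (auto simp: S'_def)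
    have "prod a S = a 1 * a 2 * prod a S'"
      unfolding S using fin by (simp add: S'_def mult.assoc)
    moreover have "pos ` S = insert (n + 1) (pos ` S')"
      unfolding S by (simp add: pos_def)
    moreover have "n + 1 \<notin> pos ` S'" by (auto simp: S'_def pos_def)
    moreover have "a 1 * a 2 = b (n + 1)" using assms(3)[OF True] by (simp add: pos_def)
    ultimately show ?thesis using fin S' by simp
  next
    case False
    have "S' = S"
    proof
      show "S \<subseteq> S'"
      proof
        fix j assume j: "j \<in> S"
        then have "j \<noteq> 1" "j \<noteq> 2" "j \<in> {1..n}" using False assms(1,2) by auto
        then show "j \<in> S'" using j by (auto simp: S'_def)
      qed
    qed (simp add: S'_def)
    then show ?thesis using S' by simp
  qed
qed

text \<open>For \<open>i\<close> at least 3 the row \<open>pos i\<close> is at least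
  \<open>n + 2\<close>, so its neighbours stay in the right half, where \<open>pos\<close> is onto.
  Row \<open>n + 1\<close> is different: it also has the neighbour \<open>n\<close>.\<close>

lemma pos_image_arcs:
  assumes "i \<in> {3..n}"
  shows "pos ` (parcs Q `` {i}) = parcs \<Lambda> `` {pos i}"
    "pos ` ((parcs Q)\<inverse> `` {i}) = (parcs \<Lambda>)\<inverse> `` {pos i}"
proof -
  have i: "i \<in> {1..n}" "pos i \<ge> n + 2" using assms by (auto simp: pos_def)
  have Q: "j \<in> {1..n}" if "(i, j) \<in> parcs Q \<or> (j, i) \<in> parcs Q" for j
    using that D.arcs_subset verts_Q by auto
  have right: "s \<in> {n + 1..2 * n - 1}" if "(pos i, s) \<in> parcs \<Lambda> \<or> (s, pos i) \<in> parcs \<Lambda>" for s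
    using that A.arcD[of "pos i" s] A.arcD[of s "pos i"] i(2) by auto
  show "pos ` (parcs Q `` {i}) = parcs \<Lambda> `` {pos i}"
  proof (intro equalityI subsetI)
    fix s assume s: "s \<in> parcs \<Lambda> `` {pos i}"
    then obtain j where "j \<in> {1..n}" "s = pos j" using right[of s] pos_surj[of s] by auto
    then show "s \<in> pos ` (parcs Q `` {i})" using s arc_Q_iff[OF i(1), of j] by auto
  next
    fix s assume "s \<in> pos ` (parcs Q `` {i})"
    then obtain j where "(i, j) \<in> parcs Q" "s = pos j" by auto
    then show "s \<in> parcs \<Lambda> `` {pos i}" using Q[of j] arc_Q_iff[OF i(1), of j] by simp
  qed
  show "pos ` ((parcs Q)\<inverse> `` {i}) = (parcs \<Lambda>)\<inverse> `` {pos i}"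
  proof (intro equalityI subsetI)
    fix s assume s: "s \<in> (parcs \<Lambda>)\<inverse> `` {pos i}"
    then obtain j where "j \<in> {1..n}" "s = pos j" using right[of s] pos_surj[of s] by auto
    then show "s \<in> pos ` ((parcs Q)\<inverse> `` {i})" using s arc_Q_iff[OF _ i(1), of j] by auto
  next
    fix s assume "s \<in> pos ` ((parcs Q)\<inverse> `` {i})"
    then obtain j where "(j, i) \<in> parcs Q" "s = pos j" by auto
    then show "s \<in> (parcs \<Lambda>)\<inverse> `` {pos i}" using Q[of j] arc_Q_iff[OF _ i(1), of j] by simp
  qed
qed

lemma arcs_at_fork:
  assumes "i \<in> {1, 2}"
  shows "parcs Q `` {i} = (if (1, 3) \<in> parcs Q then {3} else {})"
    "(parcs Q)\<inverse> `` {i} = (if (1, 3) \<in> parcs Q then {} else {3})"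
proof -
  have "j = 3" if "(i, j) \<in> parcs Q \<or> (j, i) \<in> parcs Q" for j
    using that assms by (auto elim: arc_Q_cases)
  then show "parcs Q `` {i} = (if (1, 3) \<in> parcs Q then {3} else {})"
    "(parcs Q)\<inverse> `` {i} = (if (1, 3) \<in> parcs Q then {} else {3})"
    using fork_Q[OF assms] by auto
qed

lemma fork_symmetric_neighbours:
  assumes "3 \<le> i"
  shows "(i, 1) \<in> parcs Q \<longleftrightarrow> (i, 2) \<in> parcs Q" "(1, i) \<in> parcs Q \<longleftrightarrow> (2, i) \<in> parcs Q"
proof -
  have "i = 3" if "j \<in> {1, 2}" "(i, j) \<in> parcs Q \<or> (j, i) \<in> parcs Q" for j
    using that assms by (auto elim: arc_Q_cases)
  then show "(i, 1) \<in> parcs Q \<longleftrightarrow> (i, 2) \<in> parcs Q" "(1, i) \<in> parcs Q \<longleftrightarrow> (2, i) \<in> parcs Q"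
    using fork_Q[of 1] fork_Q[of 2] by auto
qed

lemma merged_value_eq:
  fixes u :: "nat \<Rightarrow> 'f::field"
  assumes C: "semifield_cone C" and u: "\<And>i. u i \<in> C"
    and "0 \<le> k" "k \<le> int n" "i \<in> {1..n}"
  defines "a \<equiv> frieze_value Q u" and "b \<equiv> frieze_value \<Lambda> (Lambda_value n u)"
  shows "(if i \<le> 2 then a (k, 1) * a (k, 2) else a (k, i)) = b (k, pos i)"
proof -
  interpret semifield_cone C by (rule C)
  obtain c where diamond: "\<And>i j. c i j * c (i + 1) (j + 1) = 1 + c (i + 1) j * c i (j + 1)"
    and fold: "\<And>i. 0 \<le> i \<Longrightarrow> i < int n \<Longrightarrow> c i (i + int n + 1) = 2 + c (i + 1) (i + int n)"
    and b_c: "\<And>k r. r \<in> {1..2 * n - 1} \<Longrightarrow> b (k, r) =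
      c (k + shift r) (k + shift r + 2 * int n + 1 - int r)"
    using frieze_Lambda_array[of C u, OF C u] unfolding b_def by blast
  have init_mem: "Lambda_value n u r \<in> C" for r
    using u by (auto simp: Lambda_value_def one_mem mult_mem)
  have "is_frieze \<Lambda> (Lambda_value n u) b" and b_mem: "\<And>k r. r \<in> pverts \<Lambda> \<Longrightarrow> b (k, r) \<in> C"
    unfolding b_def
    using A.frieze_value_positive[OF C, of "Lambda_value n u", OF init_mem] by simp_all
  then have b: "\<And>r. r \<in> {1..2 * n - 1} \<Longrightarrow> b (0, r) = Lambda_value n u r"
    "\<And>k r. r \<in> {1..2 * n - 1} \<Longrightarrow> b (k, r) * b (k + 1, r) =
      1 + (\<Prod>s\<in>parcs \<Lambda> `` {r}. b (k, s)) * (\<Prod>s\<in>(parcs \<Lambda>)\<inverse> `` {r}. b (k + 1, s))"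
    unfolding A.is_frieze_iff verts_Lambda by simp_all
  have "is_frieze Q u a"
    unfolding a_def using D.frieze_value_positive(1)[OF C, of u, OF u] .
  then have a: "\<And>i. i \<in> {1..n} \<Longrightarrow> a (0, i) = u i"
    "\<And>k i. i \<in> {1..n} \<Longrightarrow> a (k, i) * a (k + 1, i) =
      1 + (\<Prod>j\<in>parcs Q `` {i}. a (k, j)) * (\<Prod>j\<in>(parcs Q)\<inverse> `` {i}. a (k + 1, j))"
    unfolding D.is_frieze_iff verts_Q by simp_all
  have pos_vert: "pos i \<in> {1..2 * n - 1}" if "i \<in> {1..n}" for i
    using pos_in[OF that] by auto
  \<comment> \<open>Giving the merged value to both fork vertices makes \<open>m\<close> a function
    on the vertices of \<open>Q\<close>, as \<open>slices_agree\<close> requires.\<close>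
  define m where "m = (\<lambda>(k, i). if i \<le> 2 then a (k, 1) * a (k, 2) else a (k, i))"
  define m' where "m' = (\<lambda>(k, i). b (k, pos i))"
  have "m (k, i) = m' (k, i)"
  proof (rule D.slices_agree[where K = "int n"])
    fix k i assume "i \<in> pverts Q"
    then show "m' (k, i) \<noteq> 0"
      using b_mem[of "pos i" k] zero_notin pos_vert[of i] by (auto simp: m'_def verts_Q verts_Lambda)
  next
    fix i assume "i \<in> pverts Q"
    then have i: "i \<in> {1..n}" by (simp add: verts_Q)
    then show "m (0, i) = m' (0, i)"
      using n a(1)[of 1] a(1)[of 2] a(1)[OF i] b(1)[OF pos_vert[OF i]]
      by (auto simp: m_def m'_def Lambda_value_def pos_def)
  next
    fix k i assume k: "0 \<le> k" "k < int n" and "i \<in> pverts Q"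
      and out: "\<And>j. (i, j) \<in> parcs Q \<Longrightarrow> m (k, j) = m' (k, j)"
      and into: "\<And>j. (j, i) \<in> parcs Q \<Longrightarrow> m (k + 1, j) = m' (k + 1, j)"
    then have i: "i \<in> {1..n}" by (simp add: verts_Q)
    show "m (k, i) * m (k + 1, i) = m' (k, i) * m' (k + 1, i)"
    proof (cases "i \<le> 2")
      case True
      then have i12: "i \<in> {1, 2}" using i by auto
      \<comment> \<open>The joint is the sole neighbour of a fork vertex and is met in slice
        \<open>k\<close> or \<open>k + 1\<close>. By the symmetric fork it is the same slice for
        both fork vertices, so their relations multiply to a square.\<close>
      define x where "x = (if (1, 3) \<in> parcs Q then a (k, 3) else a (k + 1, 3))"
      have step: "a (k, j) * a (k + 1, j) = 1 + x" if "j \<in> {1, 2}" for j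
        using a(2)[of j k] n that unfolding arcs_at_fork[OF that] by (auto simp: x_def)
      have "m (k, i) * m (k + 1, i) = (a (k, 1) * a (k + 1, 1)) * (a (k, 2) * a (k + 1, 2))"
        using True by (simp add: m_def)
      also have "\<dots> = (1 + x) * (1 + x)" using step by simp
      finally have lhs: "m (k, i) * m (k + 1, i) = (1 + x) * (1 + x)" .
      have "x = (if (1, 3) \<in> parcs Q then b (k, n + 2) else b (k + 1, n + 2))"
        using out[of 3] into[of 3] fork_Q[OF i12] by (auto simp: x_def m_def m'_def pos_def numeral_3_eq_3)
      also have "\<dots> = c (k + 1) (k + int n)"
      proof -
        \<comment> \<open>The shift compensates for the slice in which the joint is read, so both
          orientations lead to the same entry.\<close>
        have "shift (n + 2) = (if (1, 3) \<in> parcs Q then 1 else 0)"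
          using shift_Suc[of "n + 1"] shift_middle(1) Lambda_arc_iff(1)[of 1] n
          by (simp add: rising_def label_def numeral_3_eq_3)
        then show ?thesis using b_c[of "n + 2"] n by (auto simp: algebra_simps)
      qed
      finally have x: "x = c (k + 1) (k + int n)" .
      have "m' (k, i) * m' (k + 1, i) = c k (k + int n) * c (k + 1) (k + int n + 1)"
        using True n b_c[of "n + 1"] shift_middle(1) by (simp add: m'_def pos_def algebra_simps)
      \<comment> \<open>In the diamond relation the neighbour above is \<open>x\<close>, the one
        below is \<open>2 + x\<close> by the trace identity. The latter asks for
        \<open>k < int n\<close>, which holds for every step up to slice \<open>n\<close>.\<close>
      also have "\<dots> = 1 + x * (2 + x)"
        unfolding x using diamond[of k "k + int n"] fold[OF k] by simp
      finally show ?thesis using lhs by (simp add: algebra_simps)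
    next
      case False
      then have i3: "i \<in> {3..n}" using i by auto
      have arcs: "parcs Q `` {i} \<subseteq> {1..n}" "(parcs Q)\<inverse> `` {i} \<subseteq> {1..n}"
        using D.arcs_subset verts_Q by auto
      have "(\<Prod>j\<in>parcs Q `` {i}. a (k, j)) = (\<Prod>s\<in>parcs \<Lambda> `` {pos i}. b (k, s))"
        unfolding pos_image_arcs(1)[OF i3, symmetric]
        by (rule prod_merged_fork[OF arcs(1)])
          (use fork_symmetric_neighbours[of i] i3 out in \<open>auto simp: m_def m'_def\<close>)
      moreover have "(\<Prod>j\<in>(parcs Q)\<inverse> `` {i}. a (k + 1, j)) =
          (\<Prod>s\<in>(parcs \<Lambda>)\<inverse> `` {pos i}. b (k + 1, s))"
        unfolding pos_image_arcs(2)[OF i3, symmetric]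
        by (rule prod_merged_fork[OF arcs(2)])
          (use fork_symmetric_neighbours[of i] i3 into in \<open>auto simp: m_def m'_def\<close>)
      ultimately have "a (k, i) * a (k + 1, i) = b (k, pos i) * b (k + 1, pos i)"
        unfolding a(2)[OF i] b(2)[OF pos_vert[OF i]] by simp
      then show ?thesis using False by (simp add: m_def m'_def)
    qed
  qed (use assms in \<open>simp_all add: verts_Q\<close>)
  then show ?thesis by (simp add: m_def m'_def)
qed

end


section \<open>The modelled quiver inside the fundamental quiver\<close>

lemma full_subquiver_wf:
  assumes "parcs G \<subseteq> pverts G \<times> pverts G"
  shows "wf_digraph (with_proj (full_subquiver G S))"
  using assms by (auto simp: wf_digraph_wp_iff pair_wf_digraph_def full_subquiver_def)

context symmetric_fork
begin

lemma translation_arcs_Lambda: "parcs (translation_quiver \<Lambda>) \<subseteq> pverts (translation_quiver \<Lambda>) \<times> pverts (translation_quiver \<Lambda>)"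
  using A.arcs_subset by (auto simp: translation_quiver_def)

lemma translation_arc_pos:
  assumes "i \<in> {1..n}" "j \<in> {1..n}"
  shows "((k, i), (l, j)) \<in> parcs (translation_quiver Q) \<longleftrightarrow>
    ((k, pos i), (l, pos j)) \<in> parcs (translation_quiver \<Lambda>)"
proof -
  have "((k, i), (l, j)) \<in> parcs (translation_quiver \<Theta>) \<longleftrightarrow>
      l = k \<and> (i, j) \<in> parcs \<Theta> \<or> l = k + 1 \<and> (j, i) \<in> parcs \<Theta>" for \<Theta> :: "nat quiver" and i j
    by (auto simp: translation_quiver_def)
  then show ?thesis using arc_Q_iff[OF assms] arc_Q_iff[OF assms(2,1)] by simp
qed

lemma to_Lambda_merge_fork: "1 \<le> i \<Longrightarrow> to_Lambda n (merge_fork (k, i)) = (k, pos i)"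
  by (auto simp: to_Lambda_def merge_fork_def right_pos_def pos_def)

text \<open>Fullness rests on \<open>arc_Q_iff\<close> being an equivalence: every arrow of the
  rectangle on the right-hand side comes from an arrow of \<open>Q\<close>.\<close>

lemma modelled_image:
  "image_quiver (to_Lambda n) (fst (modelled_quiver n Q u)) =
    full_subquiver (translation_quiver \<Lambda>) ({0..int n} \<times> {n + 1..2 * n - 1})"
proof -
  let ?V = "{0..int n} \<times> {1..n}" and ?W = "{0..int n} \<times> {n + 1..2 * n - 1}"
  let ?\<psi> = "\<lambda>v. to_Lambda n (merge_fork v)"
  have \<psi>: "?\<psi> (k, i) = (k, pos i)" if "i \<in> {1..n}" for k i
    using that to_Lambda_merge_fork by simp
  have surj: "\<exists>i\<in>{1..n}. (k, r) = ?\<psi> (k, i)" if "r \<in> {n + 1..2 * n - 1}" for k r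
    using that by (elim pos_surj) (auto simp: \<psi> simp del: atLeastAtMost_iff)
  have "?\<psi> ` ?V = ?W"
  proof (intro equalityI subsetI)
    fix w assume "w \<in> ?\<psi> ` ?V"
    then show "w \<in> ?W" using pos_in by (auto simp: \<psi> simp del: atLeastAtMost_iff)
  next
    fix w assume "w \<in> ?W"
    then obtain k r where w: "w = (k, r)" "k \<in> {0..int n}" "r \<in> {n + 1..2 * n - 1}" by blast
    with surj[of r k] show "w \<in> ?\<psi> ` ?V" by blast
  qed
  moreover have "?V \<subseteq> pverts (translation_quiver Q)" "?W \<subseteq> pverts (translation_quiver \<Lambda>)"
    by (auto simp: translation_quiver_def verts_Q verts_Lambda)
  ultimately have verts: "?\<psi> ` (pverts (translation_quiver Q) \<inter> ?V) = pverts (translation_quiver \<Lambda>) \<inter> ?W"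
    by (simp add: Int_absorb1)
  have "map_prod ?\<psi> ?\<psi> ` (parcs (translation_quiver Q) \<inter> ?V \<times> ?V) = parcs (translation_quiver \<Lambda>) \<inter> ?W \<times> ?W"
  proof (intro equalityI subsetI)
    fix e assume "e \<in> map_prod ?\<psi> ?\<psi> ` (parcs (translation_quiver Q) \<inter> ?V \<times> ?V)"
    then obtain k i l j where e: "e = (?\<psi> (k, i), ?\<psi> (l, j))"
      and arc: "((k, i), (l, j)) \<in> parcs (translation_quiver Q)"
      and mem: "k \<in> {0..int n}" "i \<in> {1..n}" "l \<in> {0..int n}" "j \<in> {1..n}"
      by (auto simp del: atLeastAtMost_iff)
    have "((k, pos i), (l, pos j)) \<in> parcs (translation_quiver \<Lambda>)"
      using arc translation_arc_pos[OF mem(2,4)] by blast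
    then show "e \<in> parcs (translation_quiver \<Lambda>) \<inter> ?W \<times> ?W"
      unfolding e \<psi>[OF mem(2)] \<psi>[OF mem(4)] using mem pos_in by blast
  next
    fix e assume "e \<in> parcs (translation_quiver \<Lambda>) \<inter> ?W \<times> ?W"
    then obtain k r l s where e: "e = ((k, r), (l, s))"
      and arc: "((k, r), (l, s)) \<in> parcs (translation_quiver \<Lambda>)"
      and mem: "k \<in> {0..int n}" "r \<in> {n + 1..2 * n - 1}" "l \<in> {0..int n}" "s \<in> {n + 1..2 * n - 1}"
      by (cases e) (auto simp del: atLeastAtMost_iff)
    obtain i j where i: "i \<in> {1..n}" "r = pos i" and j: "j \<in> {1..n}" "s = pos j"
      using pos_surj[OF mem(2)] pos_surj[OF mem(4)] by metis
    have "((k, i), (l, j)) \<in> parcs (translation_quiver Q) \<inter> ?V \<times> ?V"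
      using arc translation_arc_pos[OF i(1) j(1)] mem i j by blast
    moreover have "e = map_prod ?\<psi> ?\<psi> ((k, i), (l, j))"
      unfolding e map_prod_simp \<psi>[OF i(1)] \<psi>[OF j(1)] i(2) j(2) ..
    ultimately show "e \<in> map_prod ?\<psi> ?\<psi> ` (parcs (translation_quiver Q) \<inter> ?V \<times> ?V)"
      by (rule rev_image_eqI)
  qed
  then have arcs: "map_prod (to_Lambda n) (to_Lambda n) ` map_prod merge_fork merge_fork `
      (parcs (translation_quiver Q) \<inter> ?V \<times> ?V) = parcs (translation_quiver \<Lambda>) \<inter> ?W \<times> ?W"
    by (simp add: image_image map_prod.compositionality comp_def)
  show ?thesis
    using verts arcs
    by (simp add: modelled_quiver_def Let_def image_quiver_def full_subquiver_def image_image)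
qed

text \<open>Right of the centre \<open>shift r\<close> is nonnegative, so no vertex with
  \<open>k\<close> at least 0 lies left of the descending diagonal. It is at most
  \<open>r - n - 1\<close>, so the ascending diagonal is met no earlier than at
  \<open>k = n + 1\<close>.\<close>

lemma modelled_region:
  "{0..int n} \<times> {n + 1..2 * n - 1} \<subseteq>
    region_between (A.descending (A.height (n + 1))) (A.ascending (A.height (n + 1)))"
  unfolding A.region_between_diagonals
proof clarify
  fix k r assume "k \<in> {0..int n}" "r \<in> {n + 1..2 * n - 1}"
  then show "r \<in> {1..2 * n - 1} \<and> A.height (n + 1) - A.height r \<le> k \<and>
      k \<le> A.height (n + 1) + int r - A.height r"
    using shift_right_bounds[of r] by (auto simp: shift_def)
qed

lemma full_valued_subquiver:
  fixes u :: "nat \<Rightarrow> 'f::field"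
  assumes "semifield_cone C" "\<And>i. u i \<in> C"
  shows "is_full_valued_subquiver_via (to_Lambda n) (modelled_quiver n Q u)
    (fundamental_quiver (frieze \<Lambda> (Lambda_value n u))
      (A.descending (A.height (n + 1))) (A.ascending (A.height (n + 1))))"
    (is "is_full_valued_subquiver_via _ ?M (fundamental_quiver _ ?d1 ?d2)")
proof -
  let ?R = "region_between ?d1 ?d2" and ?W = "{0..int n} \<times> {n + 1..2 * n - 1}"
  have verts: "pverts (fst ?M) \<subseteq> {0..int n} \<times> ({1..n} - {2})"
    using n by (auto simp: modelled_quiver_def Let_def image_quiver_def full_subquiver_def merge_fork_def
        split: if_splits)
  have to_Lambda: "to_Lambda n (k, i) = (k, pos i)" if "i \<in> {1..n} - {2}" for k i
    using that by (auto simp: to_Lambda_def right_pos_def pos_def)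
  have "inj_on (to_Lambda n) ({0..int n} \<times> ({1..n} - {2}))"
    by (auto simp: inj_on_def to_Lambda_def right_pos_def split: if_splits)
  then have "inj_on (to_Lambda n) (pverts (fst ?M))" using verts by (rule inj_on_subset)
  moreover have "induced_subgraph (with_proj (full_subquiver (translation_quiver \<Lambda>) ?W))
      (with_proj (full_subquiver (translation_quiver \<Lambda>) ?R))"
    using modelled_region full_subquiver_wf[OF translation_arcs_Lambda] translation_arcs_Lambda
    by (auto simp: induced_subgraph_def subgraph_def compatible_def full_subquiver_def)
  moreover have "frieze_value \<Lambda> (Lambda_value n u) (to_Lambda n v) = snd ?M v"
    if v: "v \<in> pverts (fst ?M)" for v
  proof -
    obtain k i where ki: "v = (k, i)" "k \<in> {0..int n}" "i \<in> {1..n} - {2}" using v verts by blast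
    have "frieze_value \<Lambda> (Lambda_value n u) (k, pos i) = (if i \<le> 2
        then frieze_value Q u (k, 1) * frieze_value Q u (k, 2) else frieze_value Q u (k, i))"
      using ki merged_value_eq[OF assms, of k i] by simp
    also have "\<dots> = snd ?M v"
      using ki by (auto simp: modelled_quiver_def Let_def)
    finally show ?thesis using ki to_Lambda by simp
  qed
  ultimately show ?thesis
    unfolding is_full_valued_subquiver_via_def modelled_image
    by (simp add: fundamental_quiver_def frieze_def)
qed

end

lemma semifield_cone_positive_ratfuns: "semifield_cone positive_ratfuns"
  by unfold_locales (auto intro: one_in_positive_ratfuns zero_notin_positive_ratfuns
      positive_ratfuns_add positive_ratfuns_mult positive_ratfuns_divide
      dest: zero_notin_positive_ratfuns[THEN notE])

theorem theorem2p13: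
  fixes n :: nat and Q :: "nat quiver"
  assumes "n \<ge> 4"
    and "type_D n Q"
    and "fork_enters_joint Q \<or> fork_leaves_joint Q"
  shows "\<exists>k0 d1 d2.
    fundamental_diagonals (2 * n - 1) (Lambda_quiver n Q) k0 d1 d2 \<and>
    (0, n + 1) \<in> set d1 \<and>
    is_full_valued_subquiver_via (to_Lambda n)
      (modelled_quiver n Q indet)
      (fundamental_quiver (frieze (Lambda_quiver n Q) (Lambda_value n indet)) d1 d2)"
proof -
  interpret symmetric_fork n Q by unfold_locales (rule assms)+
  \<comment> \<open>\<open>k + A.height r\<close> is constant on a descending diagonal; at
    \<open>(0, n + 1)\<close> it equals \<open>A.height (n + 1)\<close>, which explains the
    parameter.\<close>
  have "(0, n + 1) \<in> set (A.descending (A.height (n + 1)))"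
    unfolding A.mem_descending using assms(1) by simp
  moreover have "1 \<le> 2 * n - 1" using assms(1) by simp
  ultimately show ?thesis
    using A.fundamental_diagonals full_valued_subquiver[OF semifield_cone_positive_ratfuns]
      indet_in_positive_ratfuns by blast
qed


end
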